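(* Let $\omega\ne0$ and consider the planar system $$\dot v=\mu v-\omega w+f(v,w),\qquad \dot w=\omega v+\mu w+g(v,w),$$ $$f=a_{11}v|v|+a_{12}v|w|+a_{21}w|v|+a_{22}w|w|,\qquad g=b_{11}v|v|+b_{12}v|w|+b_{21}w|v|+b_{22}w|w|,$$ with real coefficients and $\mu\in\mathbb{R}$. Let $\sigma_{\#}=2a_{11}+a_{12}+b_{21}+2b_{22}$. If $\sigma_{\#}\ne0$, then there exists an interval $I$ around $\mu=0$ such that at $\mu=0$ the system undergoes a degenerate Hopf bifurcation in $\mu$, where the leading order amplitude of the locally unique periodic orbits is given by $$r_0(\mu)=-\frac{3\pi}{2\sigma_{\#}}\mu+\mathcal{O}(\mu^2).$$ In particular, the unique bifurcating branch of periodic solutions emerges subcritically if $\sigma_{\#}>0$ and supercritically if $\sigma_{\#}<0$. Moreover, the bifurcating periodic orbits have exchanged stability with the equilibrium at $r=0$, i.e., they are stable if they exist for $\mu>0$ and unstable if they exist for $\mu<0$.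
   Context: Polar coordinates are $(v,w)=(r\cos\varphi,r\sin\varphi)$; $r_0=r(0)\ge 0$ is the radius at $\varphi=0$ of the periodic orbit, whose amplitude is $r_0$ to leading order. "Degenerate Hopf bifurcation" means that a branch of periodic orbits emerges from the origin at $\mu=0$ with the stated amplitude law, linear in $\mu$ (rather than the square-root law of the generic smooth case). The bifurcation is supercritical if the bifurcating periodic orbits coexist with the more unstable equilibrium (here $\mu>0$), and subcritical if they coexist with the more stable equilibrium (here $\mu<0$). Local uniqueness is for periodic orbits in a neighborhood of the origin, $\mu\in I$. *)

theory Defs
  imports "HOL-Analysis.Analysis" "HOL-Library.Landau_Symbols"
begin

definition planar_system ::
  "real \<Rightarrow> (real \<Rightarrow> real \<Rightarrow> real) \<Rightarrow> (real \<Rightarrow> real \<Rightarrow> real) \<Rightarrow> real \<Rightarrow> real \<times> real \<Rightarrow> real \<times> real"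
where
  "planar_system \<omega> f g \<mu> =
     (\<lambda>(v, w). (\<mu> * v - \<omega> * w + f v w, \<omega> * v + \<mu> * w + g v w))"

definition ode_solution_on ::
  "('a::real_normed_vector \<Rightarrow> 'a) \<Rightarrow> real set \<Rightarrow> (real \<Rightarrow> 'a) \<Rightarrow> bool"
where
  "ode_solution_on F T x \<longleftrightarrow> (\<forall>t\<in>T. (x has_vector_derivative F (x t)) (at t within T))"

text \<open>Equilibria are not periodic orbits: the solution has to be nonconstant.\<close>

definition periodic_orbit :: "('a::real_normed_vector \<Rightarrow> 'a) \<Rightarrow> 'a set \<Rightarrow> bool" where
  "periodic_orbit F P \<longleftrightarrow>
     (\<exists>x T. T > 0 \<and> ode_solution_on F UNIV x \<and> (\<forall>t. x (t + T) = x t)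
        \<and> (\<exists>s t. x s \<noteq> x t) \<and> P = range x)"

text \<open>Stability of an invariant set \<open>P\<close>: orbital stability if \<open>P\<close> is a periodic orbit, the usual
  stability of an equilibrium \<open>p\<close> if \<open>P = {p}\<close>. Solutions starting near \<open>P\<close> are required to exist
  for all forward times, so that blow-up in finite time is not vacuously stable.\<close>

definition lyapunov_stable :: "('a::real_normed_vector \<Rightarrow> 'a) \<Rightarrow> 'a set \<Rightarrow> bool" where
  "lyapunov_stable F P \<longleftrightarrow>
     (\<forall>\<epsilon>>0. \<exists>\<delta>>0. \<forall>p. infdist p P < \<delta> \<longrightarrow>
        (\<exists>x. ode_solution_on F {0..} x \<and> x 0 = p) \<and>
        (\<forall>x. ode_solution_on F {0..} x \<and> x 0 = p \<longrightarrow> (\<forall>t\<ge>0. infdist (x t) P < \<epsilon>)))"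

definition asymptotically_stable :: "('a::real_normed_vector \<Rightarrow> 'a) \<Rightarrow> 'a set \<Rightarrow> bool" where
  "asymptotically_stable F P \<longleftrightarrow>
     lyapunov_stable F P \<and>
     (\<exists>\<delta>>0. \<forall>x. ode_solution_on F {0..} x \<and> infdist (x 0) P < \<delta> \<longrightarrow>
        ((\<lambda>t. infdist (x t) P) \<longlongrightarrow> 0) at_top)"

abbreviation unstable :: "('a::real_normed_vector \<Rightarrow> 'a) \<Rightarrow> 'a set \<Rightarrow> bool" where
  "unstable F P \<equiv> \<not> lyapunov_stable F P"

definition amplitude :: "'a::real_normed_vector set \<Rightarrow> real" where
  "amplitude P = (SUP p\<in>P. norm p)"

text \<open>Degenerate Hopf bifurcation from the origin at \<open>\<mu> = 0\<close> with amplitude law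
  \<open>r\<^sub>0 \<mu> = c * \<mu> + O(\<mu>\<^sup>2)\<close>. Here \<open>I\<close> is the parameter interval, \<open>U\<close> the neighbourhood of the origin
  in which the periodic orbits are unique, \<open>J\<close> the set of those parameters in \<open>I\<close> for which a
  periodic orbit exists in \<open>U\<close>, \<open>\<Gamma> \<mu>\<close> this orbit, and \<open>r\<^sub>0 \<mu>\<close> its radius at polar angle \<open>0\<close>, i.e. the
  abscissa of its unique point on the nonnegative first coordinate axis.
  As \<open>r\<^sub>0\<close> is a radius, the asymptotics only make sense on \<open>J\<close>. Continuity of \<open>r\<^sub>0\<close> up to
  \<open>r\<^sub>0 0 = 0\<close> expresses that the periodic orbits form a branch emerging from the origin.\<close>

definition degenerate_Hopf ::
  "(real \<Rightarrow> real \<times> real \<Rightarrow> real \<times> real) \<Rightarrow> real \<Rightarrow> real set \<Rightarrow> (real \<times> real) set \<Rightarrow> real set \<Rightarrow>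
   (real \<Rightarrow> (real \<times> real) set) \<Rightarrow> (real \<Rightarrow> real) \<Rightarrow> bool"
where
  "degenerate_Hopf F c I U J \<Gamma> r\<^sub>0 \<longleftrightarrow>
     open I \<and> is_interval I \<and> 0 \<in> I \<and> open U \<and> (0, 0) \<in> U \<and>
     (\<forall>\<mu>\<in>I. F \<mu> (0, 0) = (0, 0)) \<and>
     J \<subseteq> I - {0} \<and> 0 islimpt J \<and>
     (\<forall>\<mu>\<in>I. \<forall>P. periodic_orbit (F \<mu>) P \<and> P \<subseteq> U \<longleftrightarrow> \<mu> \<in> J \<and> P = \<Gamma> \<mu>) \<and>
     (\<forall>\<mu>\<in>J. r\<^sub>0 \<mu> > 0 \<and> {r. r \<ge> 0 \<and> (r, 0) \<in> \<Gamma> \<mu>} = {r\<^sub>0 \<mu>}) \<and>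
     r\<^sub>0 0 = 0 \<and> continuous_on (insert 0 J) r\<^sub>0 \<and>
     (\<lambda>\<mu>. amplitude (\<Gamma> \<mu>)) \<sim>[at 0 within J] r\<^sub>0 \<and>
     c \<noteq> 0 \<and> (\<lambda>\<mu>. r\<^sub>0 \<mu> - c * \<mu>) \<in> O[at 0 within J](\<lambda>\<mu>. \<mu>\<^sup>2)"

text \<open>\<open>I\<close> and \<open>J\<close> are as before; the equilibrium is the origin.\<close>

definition supercritical ::
  "(real \<Rightarrow> real \<times> real \<Rightarrow> real \<times> real) \<Rightarrow> real set \<Rightarrow> real set \<Rightarrow> bool"
where
  "supercritical F I J \<longleftrightarrow>
     (\<forall>\<mu>\<in>J. unstable (F \<mu>) {(0, 0)}) \<and>
     (\<forall>\<mu>\<in>I - J - {0}. asymptotically_stable (F \<mu>) {(0, 0)})"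

definition subcritical ::
  "(real \<Rightarrow> real \<times> real \<Rightarrow> real \<times> real) \<Rightarrow> real set \<Rightarrow> real set \<Rightarrow> bool"
where
  "subcritical F I J \<longleftrightarrow>
     (\<forall>\<mu>\<in>J. asymptotically_stable (F \<mu>) {(0, 0)}) \<and>
     (\<forall>\<mu>\<in>I - J - {0}. unstable (F \<mu>) {(0, 0)})"

end

theory Submission
  imports Defs
begin

text \<open>In polar coordinates \<open>r' = \<mu> r + A(\<phi>) r\<^sup>2\<close> and \<open>\<phi>' = \<omega> + B(\<phi>) r\<close>, so \<open>\<rho> = 1 / r\<close> satisfies the
  almost linear equation \<open>\<rho>' = - \<mu> \<rho> - A(\<phi>)\<close>, and \<open>A\<close> has mean \<open>2 \<sigma> / (3 \<pi>)\<close>. As a function of the angle, a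
  periodic orbit is a periodic solution \<open>\<rho> = P(\<phi>)\<close> of a scalar equation which, after averaging, is a
  small perturbation of \<open>y' = - (\<mu> / \<omega>) y\<close>; the contraction principle yields \<open>P\<close>, at bounded
  distance from \<open>- 2 \<sigma> / (3 \<pi> \<mu>)\<close>. Along every solution in a
  \<open>\<mu>\<close>-independent punctured neighbourhood of the origin, \<open>d = 1 / r - P(\<phi>)\<close> satisfies
  \<open>d' = (- \<mu> + c) d\<close> with \<open>\<bar>c\<bar> \<le> \<bar>\<mu>\<bar> / 2\<close>. Hence \<open>d\<^sup>2\<close> is a Lyapunov function that gives uniqueness
  of the periodic orbit as well as its stability type.\<close>

subsection \<open>Ordinary differential equations\<close>

text \<open>The field is Lipschitz but in general not differentiable across the axes, so Poincare
  maps and their derivatives are replaced by scalar inequalities that rest on continuity and bounds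
  of \<open>A\<close> and \<open>B\<close>. The obstacle is that \<open>d\<close> contracts or
  expands only at a rate of order \<open>\<mu>\<close>, while the neighbourhood of uniqueness must
  not shrink with \<open>\<mu>\<close>. This succeeds because the comparison curve is an exact
  solution: the rate of change of \<open>d\<close> then vanishes exactly at \<open>d = 0\<close>,
  and the factor left after dividing by \<open>d\<close> contains \<open>1 / P\<close>, which is
  itself of order \<open>\<mu>\<close>. Hence it suffices that r stays below a constant
  \<open>\<delta>\<close> built from the coefficients. Comparing with the averaged radius alone
  would leave an error that is not proportional to \<open>d\<close>. For \<open>\<mu> = 0\<close>
  and for \<open>\<mu>\<close> of the wrong sign there is no such curve, and nonexistence rests on
  another monotone quantity. Since stability includes existence for all forward times, solutions
  have to be constructed as well.\<close>

text \<open>The weight \<open>exp (- c * t)\<close> makes \<open>u\<close> nonincreasing. The rate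
  \<open>c\<close> may have either sign, and derivatives are taken within the interval because
  solutions live on \<open>{0..}\<close> only.\<close>

lemma gronwall_within:
  fixes u u' :: "real \<Rightarrow> real"
  assumes "a \<le> b"
    and der: "\<And>t. t \<in> {a..b} \<Longrightarrow> (u has_real_derivative u' t) (at t within {a..b})"
    and le: "\<And>t. t \<in> {a..b} \<Longrightarrow> u' t \<le> c * u t"
  shows "u b \<le> exp (c * (b - a)) * u a"
proof -
  define h where "h t = exp (- c * t) * u t" for t
  have hder: "(h has_real_derivative exp (- c * t) * (u' t - c * u t)) (at t within {a..b})"
    if "t \<in> {a..b}" for t
    unfolding h_def
    by (auto intro!: derivative_eq_intros der[OF that] simp: algebra_simps)
  have "h b \<le> h a"
  proof (rule DERIV_nonpos_imp_decreasing_open[OF \<open>a \<le> b\<close>])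
    show "continuous_on {a..b} h"
      by (rule DERIV_continuous_on[OF hder])
    fix t assume t: "a < t" "t < b"
    then have "at t within {a..b} = at t"
      by (intro at_within_interior) auto
    with hder[of t] t have "DERIV h t :> exp (- c * t) * (u' t - c * u t)" by simp
    moreover have "exp (- c * t) * (u' t - c * u t) \<le> 0"
      using le[of t] t by (intro mult_nonneg_nonpos) auto
    ultimately show "\<exists>y. DERIV h t :> y \<and> y \<le> 0" by blast
  qed
  then have "exp (c * b) * h b \<le> exp (c * b) * h a" by simp
  moreover have "exp (c * b) * h b = u b" "exp (c * b) * h a = exp (c * (b - a)) * u a"
    by (simp_all add: h_def mult.assoc[symmetric] exp_add[symmetric] right_diff_distrib)
  ultimately show ?thesis by simp
qed

lemma ode_solution_on_subset:
  "ode_solution_on F T x \<Longrightarrow> S \<subseteq> T \<Longrightarrow> ode_solution_on F S x"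
  unfolding ode_solution_on_def using has_vector_derivative_within_subset by blast

lemma ode_solution_on_continuous_on:
  "ode_solution_on F T x \<Longrightarrow> continuous_on T x"
  unfolding ode_solution_on_def by (rule continuous_on_vector_derivative) auto

lemma ode_solution_on_shift:
  assumes "ode_solution_on F UNIV x"
  shows "ode_solution_on F UNIV (\<lambda>t. x (t + s))"
  unfolding ode_solution_on_def
proof
  fix t :: real
  have "((\<lambda>t. t + s) has_real_derivative 1) (at t)"
    by (auto intro!: derivative_eq_intros)
  moreover have "(x has_vector_derivative F (x (t + s))) (at (t + s))"
    using assms by (simp add: ode_solution_on_def)
  ultimately show "((\<lambda>t. x (t + s)) has_vector_derivative F (x (t + s))) (at t)"
    using vector_diff_chain_at[of "\<lambda>t. t + s" 1 t x]
    by (simp add: o_def has_real_derivative_iff_has_vector_derivative)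
qed

text \<open>Gronwall for the squared distance, which starts at 0. The Lipschitz condition is
  localised to a set \<open>K\<close> containing both trajectories, since the quadratic field is
  Lipschitz on balls only.\<close>

lemma ode_solution_on_unique:
  fixes F :: "'a::euclidean_space \<Rightarrow> 'a"
  assumes x: "ode_solution_on F {0..} x" and y: "ode_solution_on F {0..} y"
    and x0: "x 0 = y 0"
    and lip: "L-lipschitz_on K F"
    and xK: "\<And>t. t \<ge> 0 \<Longrightarrow> x t \<in> K" and yK: "\<And>t. t \<ge> 0 \<Longrightarrow> y t \<in> K"
    and "t \<ge> 0"
  shows "x t = y t"
proof -
  define u where "u t = (x t - y t) \<bullet> (x t - y t)" for t
  define u' where "u' t = 2 * ((x t - y t) \<bullet> (F (x t) - F (y t)))" for t
  have "u t \<le> exp (2 * L * (t - 0)) * u 0"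
  proof (rule gronwall_within[OF \<open>t \<ge> 0\<close>])
    fix s assume s: "s \<in> {0..t}"
    have "(x has_vector_derivative F (x s)) (at s within {0..t})"
         "(y has_vector_derivative F (y s)) (at s within {0..t})"
      using x y s by (auto simp: ode_solution_on_def intro: has_vector_derivative_within_subset)
    then have d: "((\<lambda>s. x s - y s) has_vector_derivative F (x s) - F (y s)) (at s within {0..t})"
      by (rule has_vector_derivative_diff)
    show "(u has_real_derivative u' s) (at s within {0..t})"
      unfolding u_def u'_def has_real_derivative_iff_has_vector_derivative
      by (rule has_vector_derivative_eq_rhs[OF
            bounded_bilinear.has_vector_derivative[OF bounded_bilinear_inner d d]])
         (simp add: inner_commute)
    have "(x s - y s) \<bullet> (F (x s) - F (y s)) \<le> norm (x s - y s) * norm (F (x s) - F (y s))"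
      by (rule norm_cauchy_schwarz)
    also have "\<dots> \<le> norm (x s - y s) * (L * norm (x s - y s))"
      using lipschitz_on_normD[OF lip, of "x s" "y s"] xK[of s] yK[of s] s
      by (intro mult_left_mono) auto
    finally show "u' s \<le> 2 * L * u s"
      by (simp add: u_def u'_def dot_square_norm power2_eq_square algebra_simps)
  qed
  then have "(x t - y t) \<bullet> (x t - y t) \<le> 0" using x0 by (simp add: u_def)
  then show ?thesis
    by (metis eq_iff_diff_eq_0 inner_gt_zero_iff not_less)
qed

text \<open>The weight \<open>exp (- 2 * L * t)\<close> makes the Picard operator a contraction on all of
  \<open>{0..}\<close> at once, so no local solutions have to be glued.\<close>

lemma lipschitz_ode_solution_exists:
  fixes F :: "'a::euclidean_space \<Rightarrow> 'a"
  assumes lip: "L-lipschitz_on UNIV F" and bd: "\<And>p. norm (F p) \<le> M"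
  shows "\<exists>x. ode_solution_on F {0..} x \<and> x 0 = p"
proof -
  \<comment> \<open>The weighted operator contracts by \<open>L / K\<close>; \<open>L + 1\<close> in
    place of \<open>L\<close> keeps \<open>K\<close> positive when \<open>L = 0\<close>.\<close>
  define K where "K = 2 * (L + 1)"
  have L0: "L \<ge> 0" using lip by (rule lipschitz_on_nonneg)
  have K: "K > 0" "L / K \<le> 1 / 2" using L0 by (auto simp: K_def field_simps)
  have M0: "M \<ge> 0" using bd[of 0] norm_ge_zero order_trans by blast
  have contF: "continuous_on S F" for S
    using lip lipschitz_on_continuous_on continuous_on_subset by blast
  \<comment> \<open>The unknown \<open>y\<close> stands for \<open>exp (- K * t)\<close> times the
    sought solution, so \<open>g y\<close> is the field along the unweighted curve.\<close>
  define g where "g y t = F (exp (K * t) *\<^sub>R apply_bcontfun y t)" for y :: "real \<Rightarrow>\<^sub>C 'a" and t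
  have contg: "continuous_on S (g y)" for S y
    unfolding g_def
    by (rule continuous_on_compose2[OF contF[of UNIV]]) (auto intro!: continuous_intros)
  \<comment> \<open>Bounded continuous functions live on the whole line; \<open>max 0 t\<close>
    freezes the curve at \<open>p\<close> for negative times.\<close>
  define G where "G y t = p + integral {0..max 0 t} (g y)" for y t
  have derG: "(G y has_vector_derivative g y t) (at t within {0..})" if "t \<ge> 0" for y t
  proof -
    have "((\<lambda>u. integral {0..u} (g y)) has_vector_derivative g y t) (at t within {0..t+1})"
      by (rule integral_has_vector_derivative[OF contg]) (use that in auto)
    then have "((\<lambda>u. integral {0..u} (g y)) has_vector_derivative g y t) (at t within {0..})"
      by (subst (asm) at_within_nhd[of t "{..<t+1}" _ "{0..}"]) auto
    then have "((\<lambda>u. p + integral {0..u} (g y)) has_vector_derivative g y t) (at t within {0..})"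
      by (auto intro!: derivative_eq_intros)
    then show ?thesis
      by (rule has_vector_derivative_transform[rotated 2]) (use that in \<open>auto simp: G_def\<close>)
  qed
  have contG: "continuous_on UNIV (G y)" for y
  proof -
    have 1: "continuous_on {0..} (G y)"
      by (rule continuous_on_vector_derivative[OF derG]) simp
    have "continuous_on UNIV (\<lambda>t. G y (max 0 t))"
      by (rule continuous_on_compose2[OF 1]) (auto intro!: continuous_intros)
    then show ?thesis by (simp add: G_def)
  qed
  define T where "T y t = exp (- K * max 0 t) *\<^sub>R G y t" for y t
  have intexp: "((\<lambda>s. c * exp (K * s)) has_integral c * (exp (K * t) - 1) / K) {0..t}"
    if "t \<ge> 0" for c t :: real
  proof -
    have "((\<lambda>s. c * exp (K * s)) has_integral (c / K * exp (K * t) - c / K * exp (K * 0))) {0..t}"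
      by (rule fundamental_theorem_of_calculus[OF that])
         (use K in \<open>auto intro!: derivative_eq_intros
            simp: has_real_derivative_iff_has_vector_derivative[symmetric]\<close>)
    then show ?thesis by (simp add: diff_divide_distrib algebra_simps)
  qed
  have intle: "norm (integral {0..t} h) \<le> c / K * exp (K * t)"
    if "t \<ge> 0" "c \<ge> 0" "continuous_on {0..t} h" "\<And>s. s \<in> {0..t} \<Longrightarrow> norm (h s) \<le> c * exp (K * s)"
    for h :: "real \<Rightarrow> 'a" and c t
  proof -
    have "norm (integral {0..t} h) \<le> integral {0..t} (\<lambda>s. c * exp (K * s))"
      by (rule integral_norm_bound_integral)
         (use that intexp[OF that(1), of c] in \<open>auto intro: integrable_continuous_real\<close>)
    also have "\<dots> = c * (exp (K * t) - 1) / K"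
      using intexp[OF that(1), of c] by (rule integral_unique)
    also have "\<dots> \<le> c / K * exp (K * t)"
      using that K by (simp add: field_simps)
    finally show ?thesis .
  qed
  have Tb: "T y \<in> bcontfun" for y
  proof (rule bcontfun_normI)
    show "continuous_on UNIV (T y)"
      unfolding T_def by (intro continuous_intros contG)
    fix t :: real
    define s where "s = max 0 t"
    have s: "s \<ge> 0" by (simp add: s_def)
    have "norm (integral {0..s} (g y)) \<le> M / K * exp (K * s)"
    proof (rule intle[OF s M0 contg])
      fix r assume "r \<in> {0..s}"
      then have "1 \<le> exp (K * r)" using K by simp
      then have "M \<le> M * exp (K * r)" using M0 mult_left_mono by fastforce
      then show "norm (g y r) \<le> M * exp (K * r)"
        unfolding g_def using bd order_trans by blast
    qed
    then have "exp (- K * s) * norm (integral {0..s} (g y)) \<le> exp (- K * s) * (M / K * exp (K * s))"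
      by (intro mult_left_mono) auto
    also have "\<dots> = M / K"
      by (simp add: exp_minus field_simps)
    finally have 1: "exp (- K * s) * norm (integral {0..s} (g y)) \<le> M / K" .
    have 2: "exp (- K * s) * norm p \<le> norm p"
      using s K by (intro mult_left_le_one_le) auto
    have "norm (T y t) = exp (- K * s) * norm (p + integral {0..s} (g y))"
      by (simp add: T_def G_def s_def)
    also have "\<dots> \<le> exp (- K * s) * (norm p + norm (integral {0..s} (g y)))"
      by (intro mult_left_mono norm_triangle_ineq) auto
    also have "\<dots> \<le> norm p + M / K" using 1 2 by (simp add: distrib_left)
    finally show "norm (T y t) \<le> norm p + M / K" .
  qed
  have "\<exists>!y. Bcontfun (T y) = y"
  proof (rule banach_fix_type[of "1/2"], simp, simp, intro allI)
    fix y z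
    have "dist (T y t) (T z t) \<le> 1 / 2 * dist y z" for t
    proof -
      define s where "s = max 0 t"
      have s: "s \<ge> 0" by (simp add: s_def)
      have I: "g y integrable_on {0..s}" "g z integrable_on {0..s}"
        by (auto intro!: integrable_continuous_real contg)
      have "norm (integral {0..s} (\<lambda>r. g y r - g z r)) \<le> L * dist y z / K * exp (K * s)"
      proof (rule intle[OF s])
        show "0 \<le> L * dist y z" using L0 by simp
        show "continuous_on {0..s} (\<lambda>r. g y r - g z r)"
          by (intro continuous_intros contg)
        fix r
        have "norm (g y r - g z r) \<le> L * norm (exp (K * r) *\<^sub>R apply_bcontfun y r - exp (K * r) *\<^sub>R apply_bcontfun z r)"
          unfolding g_def by (rule lipschitz_on_normD[OF lip]) auto
        also have "\<dots> = L * (exp (K * r) * dist (apply_bcontfun y r) (apply_bcontfun z r))"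
          by (simp add: dist_norm scaleR_diff_right[symmetric])
        also have "\<dots> \<le> L * (exp (K * r) * dist y z)"
          using L0 by (intro mult_left_mono dist_bounded) auto
        finally show "norm (g y r - g z r) \<le> L * dist y z * exp (K * r)"
          by (simp add: mult_ac)
      qed
      then have "exp (- K * s) * norm (integral {0..s} (g y) - integral {0..s} (g z))
          \<le> exp (- K * s) * (L * dist y z / K * exp (K * s))"
        using I by (intro mult_left_mono) (auto simp: integral_diff)
      also have "\<dots> = L / K * dist y z" by (simp add: exp_minus field_simps)
      also have "\<dots> \<le> 1 / 2 * dist y z" using K by (intro mult_right_mono) auto
      finally show ?thesis
        by (simp add: T_def G_def s_def dist_norm scaleR_diff_right[symmetric])
    qed
    then show "dist (Bcontfun (T y)) (Bcontfun (T z)) \<le> 1 / 2 * dist y z"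
      by (intro dist_bound) (simp add: Bcontfun_inverse[OF Tb])
  qed
  then obtain y where "Bcontfun (T y) = y" by blast
  then have y: "apply_bcontfun y t = T y t" for t
    by (metis Bcontfun_inverse Tb)
  have gy: "g y t = F (G y t)" if "t \<ge> 0" for t
    using that by (simp add: g_def y T_def exp_minus)
  have "ode_solution_on F {0..} (G y)"
    unfolding ode_solution_on_def using derG gy by (metis atLeast_iff)
  moreover have "G y 0 = p" by (simp add: G_def)
  ultimately show ?thesis by blast
qed

section \<open>Lyapunov functions for stability and instability of compact sets\<close>

lemma lyapunov_function_growth:
  assumes x: "ode_solution_on F {0..} x" and "b \<ge> 0"
    and xU: "\<And>t. t \<in> {0..b} \<Longrightarrow> x t \<in> U"
    and der: "\<And>p. p \<in> U \<Longrightarrow> (W has_derivative DW p) (at p)"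
    and le: "\<And>p. p \<in> U \<Longrightarrow> DW p (F p) \<le> c * (W p :: real)"
  shows "W (x b) \<le> exp (c * b) * W (x 0)"
proof -
  have "W (x b) \<le> exp (c * (b - 0)) * W (x 0)"
  proof (rule gronwall_within[OF \<open>b \<ge> 0\<close>, where u = "\<lambda>t. W (x t)"])
    fix t assume t: "t \<in> {0..b}"
    then have "(x has_vector_derivative F (x t)) (at t within {0..b})"
      using x by (auto simp: ode_solution_on_def intro: has_vector_derivative_within_subset)
    moreover have "(W has_derivative DW (x t)) (at (x t) within x ` {0..b})"
      using der[OF xU[OF t]] by (rule has_derivative_at_withinI)
    ultimately have "((W \<circ> x) has_vector_derivative DW (x t) (F (x t))) (at t within {0..b})"
      by (rule vector_derivative_diff_chain_within)
    then show "((\<lambda>t. W (x t)) has_real_derivative DW (x t) (F (x t))) (at t within {0..b})"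
      by (simp add: has_real_derivative_iff_has_vector_derivative o_def)
    show "DW (x t) (F (x t)) \<le> c * W (x t)" by (rule le[OF xU[OF t]])
  qed
  then show ?thesis by simp
qed

lemma compact_infdist_ball_subset_open:
  fixes P :: "'a::heine_borel set"
  assumes "compact P" "P \<noteq> {}" "open U" "P \<subseteq> U"
  obtains e where "e > 0" "\<And>p. infdist p P < e \<Longrightarrow> p \<in> U"
proof -
  obtain e where e: "e > 0" "(\<Union>x\<in>P. ball x e) \<subseteq> U"
    using compact_subset_open_imp_ball_epsilon_subset[OF assms(1,3,4)] .
  have "p \<in> U" if "infdist p P < e" for p
  proof -
    obtain q where "q \<in> P" "infdist p P = dist p q"
      using infdist_attains_inf[OF compact_imp_closed[OF \<open>compact P\<close>] \<open>P \<noteq> {}\<close>] by metis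
    then have "p \<in> ball q e" using that by (simp add: dist_commute)
    then show ?thesis using e \<open>q \<in> P\<close> by blast
  qed
  with e show thesis using that by blast
qed

text \<open>Stability would keep a solution in a compact neighbourhood of \<open>P\<close>, where
  \<open>W\<close> is bounded, although \<open>W\<close> grows exponentially from any positive
  initial value. Positive values are required only arbitrarily close to a single point of
  \<open>P\<close>.\<close>

lemma lyapunov_unstable:
  fixes F :: "'a::euclidean_space \<Rightarrow> 'a" and W :: "'a \<Rightarrow> real"
  assumes P: "compact P" "P \<subseteq> U" "open U" "q \<in> P"
    and der: "\<And>p. p \<in> U \<Longrightarrow> (W has_derivative DW p) (at p)"
    and ge: "\<And>p. p \<in> U \<Longrightarrow> DW p (F p) \<ge> k * W p" and "k > 0"
    and cl: "q \<in> closure {p. W p > 0}"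
  shows "unstable F P"
proof
  assume stab: "lyapunov_stable F P"
  have ne: "P \<noteq> {}" using P by blast
  obtain e where e: "e > 0" "\<And>p. infdist p P < e \<Longrightarrow> p \<in> U"
    by (rule compact_infdist_ball_subset_open[OF P(1) ne P(3,2)]) blast
  define N where "N = {p. infdist p P \<le> e / 2}"
  have N: "compact N" "N \<subseteq> U"
    using compact_infdist_le[OF ne P(1), of "e/2"] e unfolding N_def by fastforce+
  have "continuous_on N W"
    using der N by (meson continuous_at_imp_continuous_on has_derivative_continuous subsetD)
  then have "bounded (W ` N)"
    by (intro compact_imp_bounded compact_continuous_image N)
  then obtain c where "\<forall>p\<in>N. norm (W p) \<le> c"
    by (auto simp: bounded_iff)
  then have c: "W p \<le> c" if "p \<in> N" for p
    using that by (force simp: abs_le_iff)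
  obtain d where d: "d > 0" and D: "\<And>p. infdist p P < d \<Longrightarrow>
        (\<exists>x. ode_solution_on F {0..} x \<and> x 0 = p) \<and>
        (\<forall>x. ode_solution_on F {0..} x \<and> x 0 = p \<longrightarrow> (\<forall>t\<ge>0. infdist (x t) P < e / 2))"
    using stab[unfolded lyapunov_stable_def, rule_format, OF half_gt_zero[OF e(1)]] by blast
  obtain p where p: "W p > 0" "dist p q < d"
    using cl d by (auto simp: closure_approachable)
  then have "infdist p P < d" using infdist_le[OF P(4), of p] by simp
  then obtain x where x: "ode_solution_on F {0..} x" "x 0 = p"
      and xN: "\<And>t. t \<ge> 0 \<Longrightarrow> x t \<in> N"
    using D[of p] by (fastforce simp: N_def intro: less_imp_le)
  have grow: "W (x t) \<ge> exp (k * t) * W p" if "t \<ge> 0" for t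
  proof -
    have "- W (x t) \<le> exp (k * t) * (- W (x 0))"
    proof (rule lyapunov_function_growth[OF x(1) that, where U = U and DW = "\<lambda>p h. - DW p h"])
      show "x s \<in> U" if "s \<in> {0..t}" for s using xN N that by auto
      show "((\<lambda>p. - W p) has_derivative (\<lambda>h. - DW p h)) (at p)" if "p \<in> U" for p
        by (intro derivative_intros der that)
    qed (use ge in auto)
    then show ?thesis by (simp add: x)
  qed
  \<comment> \<open>At this time \<open>k * t * W p\<close> already reaches the bound
    \<open>c\<close>, and the exponential exceeds its argument.\<close>
  define t where "t = max 0 (c / (k * W p))"
  have "k * W p > 0" using p \<open>k > 0\<close> by simp
  moreover have "c / (k * W p) \<le> t" by (simp add: t_def)
  ultimately have "c \<le> k * t * W p" by (simp add: pos_divide_le_eq mult_ac)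
  also have "\<dots> < exp (k * t) * W p"
    using p exp_ge_add_one_self[of "k * t"] by (intro mult_strict_right_mono) linarith+
  also have "\<dots> \<le> W (x t)" by (rule grow) (simp add: t_def)
  also have "\<dots> \<le> c" by (rule c[OF xN]) (simp add: t_def)
  finally show False by simp
qed

text \<open>A solution starting with \<open>C * W < e\<^sup>2\<close> cannot reach distance
  \<open>e\<close>: \<open>W\<close> decreases until the first such time, when \<open>dist\<close>
  would demand \<open>C * W \<ge> e\<^sup>2\<close>. The same inequality transfers the exponential
  decay of \<open>W\<close> to the distance. The Lipschitz condition on a ball serves forward
  existence.\<close>

lemma lyapunov_asymptotically_stable:
  fixes F :: "'a::euclidean_space \<Rightarrow> 'a" and W :: "'a \<Rightarrow> real"
  assumes P: "compact P" "P \<subseteq> U" "open U" "P \<noteq> {}"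
    and der: "\<And>p. p \<in> U \<Longrightarrow> (W has_derivative DW p) (at p)"
    and le: "\<And>p. p \<in> U \<Longrightarrow> DW p (F p) \<le> - k * W p" and "k > 0"
    and W0: "\<And>p. p \<in> P \<Longrightarrow> W p = 0"
    and Wnn: "\<And>p. p \<in> U \<Longrightarrow> W p \<ge> 0"
    and "C \<ge> 0" and dist: "\<And>p. p \<in> U \<Longrightarrow> (infdist p P)\<^sup>2 \<le> C * W p"
    and lip: "L-lipschitz_on (cball 0 R) F" and UR: "U \<subseteq> cball 0 R"
  shows "asymptotically_stable F P"
proof -
  have contW: "continuous_on U W"
    using der by (meson continuous_at_imp_continuous_on has_derivative_continuous)
  obtain e0 where e0: "e0 > 0" "\<And>p. infdist p P < e0 \<Longrightarrow> p \<in> U"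
    by (rule compact_infdist_ball_subset_open[OF P(1,4,3,2)]) blast
  have near: "\<exists>d>0. \<forall>p. infdist p P < d \<longrightarrow> p \<in> U \<and> infdist p P < e \<and> C * W p < e\<^sup>2" if "e > 0" for e
  proof -
    have "open {p \<in> U. C * W p < e\<^sup>2}"
      using continuous_open_preimage[OF continuous_on_mult_left[OF contW] P(3) open_lessThan]
      by (simp add: vimage_def Int_def)
    moreover have "P \<subseteq> {p \<in> U. C * W p < e\<^sup>2}"
      using P(2) W0 \<open>e > 0\<close> by auto
    ultimately obtain d where "d > 0" "\<And>p. infdist p P < d \<Longrightarrow> p \<in> {p \<in> U. C * W p < e\<^sup>2}"
      using compact_infdist_ball_subset_open[OF P(1,4)] by metis
    then show ?thesis using \<open>e > 0\<close> by (intro exI[of _ "min d e"]) auto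
  qed
  \<comment> \<open>Stated for every field \<open>G\<close> agreeing with \<open>F\<close> on
    \<open>U\<close>, since it is applied to \<open>F\<close> itself and to a truncation of
    \<open>F\<close> whose solutions are not yet known to solve the original equation.\<close>
  have trap: "infdist (x t) P < e"
    if x: "ode_solution_on G {0..} x" and G: "\<And>p. p \<in> U \<Longrightarrow> G p = F p"
      and e: "e \<le> e0 / 2" "e > 0" and x0: "infdist (x 0) P < e" "C * W (x 0) < e\<^sup>2" and "t \<ge> 0"
    for G x e t
  proof (rule ccontr)
    assume far: "\<not> infdist (x t) P < e"
    define u where "u t = infdist (x t) P" for t
    have cu: "continuous_on {0..} u"
      unfolding u_def by (intro continuous_intros ode_solution_on_continuous_on[OF x])
    define S where "S = {s \<in> {0..t}. e \<le> u s}"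
    have "compact S"
    proof -
      have "continuous_on {0..t} u" using cu by (rule continuous_on_subset) auto
      then have "closed ({0..t} \<inter> u -` {e..})"
        by (rule continuous_closed_preimage) auto
      then have "compact ({0..t} \<inter> ({0..t} \<inter> u -` {e..}))"
        by (rule compact_Int_closed[OF compact_Icc])
      also have "{0..t} \<inter> ({0..t} \<inter> u -` {e..}) = S" by (auto simp: S_def)
      finally show ?thesis .
    qed
    moreover have "t \<in> S" using far \<open>t \<ge> 0\<close> by (simp add: S_def u_def)
    \<comment> \<open>\<open>b\<close> is the first time at distance at least \<open>e\<close>; by
      continuity the distance there equals \<open>e\<close>, so the solution has stayed in
      \<open>U\<close>.\<close>
    ultimately obtain b where b: "b \<in> S" "\<And>s. s \<in> S \<Longrightarrow> b \<le> s"
      using compact_attains_inf[of S] by blast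
    have "u b = e"
    proof (rule ccontr)
      assume "u b \<noteq> e"
      then have "u 0 \<le> e" "e \<le> u b" "u b > e" "0 \<le> b"
        using b(1) x0 by (auto simp: S_def u_def)
      then obtain s where "0 \<le> s" "s \<le> b" "u s = e"
        using IVT'[of u 0 e b] cu by (meson atLeast_iff atLeastAtMost_iff continuous_on_subset subsetI)
      then have "s \<in> S" "s \<noteq> b" using b(1) \<open>u b \<noteq> e\<close> by (auto simp: S_def)
      then show False using b(2)[of s] \<open>s \<le> b\<close> by simp
    qed
    have xU: "x s \<in> U" if "s \<in> {0..b}" for s
    proof -
      have "u s \<le> e"
      proof (cases "s = b")
        case False
        then have "s \<notin> S" using b(2)[of s] that by force
        then show ?thesis using that b(1) by (auto simp: S_def)
      qed (use \<open>u b = e\<close> in simp)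
      then show ?thesis using e e0 by (auto simp: u_def)
    qed
    have b0: "b \<ge> 0" using b(1) by (simp add: S_def)
    have "W (x b) \<le> exp (- k * b) * W (x 0)"
      by (rule lyapunov_function_growth[OF x b0 xU der]) (use le G in auto)
    also have "\<dots> \<le> W (x 0)"
      using Wnn[OF xU[of 0]] b0 \<open>k > 0\<close> by (intro mult_left_le_one_le) auto
    finally have "C * W (x b) \<le> C * W (x 0)" using \<open>C \<ge> 0\<close> by (rule mult_left_mono)
    with dist[OF xU[of b]] x0(2) b0 \<open>u b = e\<close> show False by (simp add: u_def)
  qed
  have stab: "lyapunov_stable F P"
    unfolding lyapunov_stable_def
  proof (intro allI impI)
    fix e' :: real assume "e' > 0"
    define e where "e = min e' (e0 / 2)"
    have e: "e > 0" "e \<le> e0 / 2" "e \<le> e'" using \<open>e' > 0\<close> e0 by (auto simp: e_def)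
    obtain d where d: "d > 0"
      "\<And>p. infdist p P < d \<Longrightarrow> p \<in> U \<and> infdist p P < e \<and> C * W p < e\<^sup>2"
      using near[OF e(1)] by blast
    have "(\<exists>x. ode_solution_on F {0..} x \<and> x 0 = p) \<and>
        (\<forall>x. ode_solution_on F {0..} x \<and> x 0 = p \<longrightarrow> (\<forall>t\<ge>0. infdist (x t) P < e'))"
      if p: "infdist p P < d" for p
    proof
      have "R \<ge> 0" using P UR by force
      then have R: "cball (0::'a) R \<noteq> {}" by auto
      \<comment> \<open>Projection onto the ball is 1-Lipschitz, so \<open>F\<close> composed with
        it is globally Lipschitz and bounded and has forward solutions. \<open>trap\<close> confines
        them to \<open>U\<close>, where the projection is the identity.\<close>
      define c where "c = closest_point (cball (0::'a) R)"
      have cR: "c p \<in> cball 0 R" for p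
        unfolding c_def by (rule closest_point_in_set[OF _ R]) simp
      have "1-lipschitz_on UNIV c"
        by (rule lipschitz_onI) (auto simp: c_def intro!: closest_point_lipschitz R)
      then have "(L * 1)-lipschitz_on UNIV (\<lambda>p. F (c p))"
        by (rule lipschitz_on_compose2) (rule lipschitz_on_subset[OF lip], use cR in auto)
      moreover have "bounded (F ` cball 0 R)"
        using lip by (intro compact_imp_bounded compact_continuous_image
            lipschitz_on_continuous_on) auto
      then obtain M where "\<And>p. p \<in> cball 0 R \<Longrightarrow> norm (F p) \<le> M"
        unfolding bounded_iff by blast
      then have "norm (F (c p)) \<le> M" for p using cR by blast
      ultimately obtain x where x: "ode_solution_on (\<lambda>p. F (c p)) {0..} x" "x 0 = p"
        using lipschitz_ode_solution_exists by metis
      have eqF: "F (c p) = F p" if "p \<in> U" for p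
        unfolding c_def using that UR by (subst closest_point_self) auto
      have "infdist (x t) P < e" if "t \<ge> 0" for t
        by (rule trap[OF x(1) eqF]) (use e that d(2)[OF p] x in auto)
      then have "x t \<in> U" if "t \<ge> 0" for t
        using that e e0 by force
      then have "ode_solution_on F {0..} x"
        using x(1) eqF by (auto simp: ode_solution_on_def)
      with x show "\<exists>x. ode_solution_on F {0..} x \<and> x 0 = p" by blast
      show "\<forall>x. ode_solution_on F {0..} x \<and> x 0 = p \<longrightarrow> (\<forall>t\<ge>0. infdist (x t) P < e')"
        using trap[where G = F and e = e] e d(2)[OF p] by fastforce
    qed
    with d(1) show "\<exists>d>0. \<forall>p. infdist p P < d \<longrightarrow>
        (\<exists>x. ode_solution_on F {0..} x \<and> x 0 = p) \<and>
        (\<forall>x. ode_solution_on F {0..} x \<and> x 0 = p \<longrightarrow> (\<forall>t\<ge>0. infdist (x t) P < e'))"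
      by blast
  qed
  define e where "e = e0 / 2"
  have e: "e > 0" "e \<le> e0 / 2" using e0 by (auto simp: e_def)
  obtain d where d: "d > 0"
    "\<And>p. infdist p P < d \<Longrightarrow> p \<in> U \<and> infdist p P < e \<and> C * W p < e\<^sup>2"
    using near[OF e(1)] by blast
  have "((\<lambda>t. infdist (x t) P) \<longlongrightarrow> 0) at_top"
    if x: "ode_solution_on F {0..} x" "infdist (x 0) P < d" for x
  proof -
    have xU: "x t \<in> U" if "t \<ge> 0" for t
      using trap[OF x(1) _ e(2,1), of t] d(2)[OF x(2)] that e e0(2)[of "x t"] by auto
    have bound: "(infdist (x t) P)\<^sup>2 \<le> C * (exp (- k * t) * W (x 0))" if "t \<ge> 0" for t
    proof -
      have "W (x t) \<le> exp (- k * t) * W (x 0)"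
        by (rule lyapunov_function_growth[OF x(1) that _ der le]) (use xU in auto)
      then have "C * W (x t) \<le> C * (exp (- k * t) * W (x 0))"
        using \<open>C \<ge> 0\<close> by (rule mult_left_mono)
      with dist[OF xU[OF that]] show ?thesis by simp
    qed
    have "((\<lambda>t. exp (- k * t)) \<longlongrightarrow> 0) at_top"
      using \<open>k > 0\<close>
      by (intro filterlim_compose[OF exp_at_bot] filterlim_tendsto_neg_mult_at_bot[OF tendsto_const])
         (auto simp: filterlim_ident)
    then have "((\<lambda>t. C * (exp (- k * t) * W (x 0))) \<longlongrightarrow> 0) at_top"
      using tendsto_mult_right[of "\<lambda>t. exp (- k * t)" 0 at_top "C * W (x 0)"] by (simp add: mult_ac)
    then have "((\<lambda>t. (infdist (x t) P)\<^sup>2) \<longlongrightarrow> 0) at_top"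
      by (rule tendsto_sandwich[OF _ _ tendsto_const, rotated 2])
         (use bound in \<open>auto intro!: eventually_mono[OF eventually_ge_at_top[of 0]]\<close>)
    then have "((\<lambda>t. sqrt ((infdist (x t) P)\<^sup>2)) \<longlongrightarrow> sqrt 0) at_top"
      by (rule tendsto_real_sqrt)
    then show ?thesis by (simp add: infdist_nonneg)
  qed
  with stab d(1) show ?thesis unfolding asymptotically_stable_def by blast
qed

section \<open>Periodic orbits of autonomous systems\<close>

lemma periodic_add_nat_multiple:
  fixes x :: "real \<Rightarrow> 'a"
  assumes "\<And>t. x (t + T) = x t"
  shows "x (t + real n * T) = x t"
proof (induction n)
  case (Suc n)
  have "x (t + real (Suc n) * T) = x (t + real n * T + T)" by (simp add: algebra_simps)
  then show ?case using Suc assms by simp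
qed simp

text \<open>Time is shifted so that the orbit starts at \<open>q\<close>. Adding periods makes any
  time nonnegative, so the forward half already covers the orbit and forward uniqueness applies to
  it.\<close>

lemma periodic_orbit_through:
  assumes "periodic_orbit G Q" "q \<in> Q"
  obtains y T where "T > 0" "ode_solution_on G {0..} y" "y T = y 0" "y 0 = q" "Q = y ` {0..}"
proof -
  obtain x T where x: "T > 0" "ode_solution_on G UNIV x" "\<And>t. x (t + T) = x t" "Q = range x"
    using assms(1) unfolding periodic_orbit_def by blast
  obtain s where s: "q = x s" using assms(2) x(4) by blast
  have "x t \<in> (\<lambda>t. x (t + s)) ` {0..}" for t
  proof -
    obtain n where "s - t < real n * T" using reals_Archimedean3[OF x(1)] by blast
    then have "t + real n * T - s \<in> {0..}" by simp
    moreover have "x (t + real n * T - s + s) = x t"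
      using periodic_add_nat_multiple[of x T t n] x(3) by simp
    ultimately show ?thesis by (metis imageI)
  qed
  then have "Q = (\<lambda>t. x (t + s)) ` {0..}" using x(4) by auto
  moreover have "ode_solution_on G {0..} (\<lambda>t. x (t + s))"
    using ode_solution_on_shift[OF x(2)] ode_solution_on_subset by blast
  moreover have "x (T + s) = x (0 + s)" using x(3)[of s] by (simp add: add.commute)
  ultimately show thesis using that[of T "\<lambda>t. x (t + s)"] x(1) s by simp
qed

lemma periodic_orbit_nontrivial:
  assumes "periodic_orbit G Q" shows "Q \<noteq> {q}"
  using assms unfolding periodic_orbit_def by (metis rangeI singletonD)

lemma periodic_orbit_eqI:
  fixes G :: "'a::euclidean_space \<Rightarrow> 'a"
  assumes "periodic_orbit G Q" "periodic_orbit G Q'" "q \<in> Q" "q \<in> Q'"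
    and lip: "L-lipschitz_on K G" and K: "Q \<subseteq> K" "Q' \<subseteq> K"
  shows "Q = Q'"
proof -
  obtain y T where y: "ode_solution_on G {0..} y" "y 0 = q" "Q = y ` {0..}"
    using periodic_orbit_through[OF assms(1,3)] by metis
  obtain y' T' where y': "ode_solution_on G {0..} y'" "y' 0 = q" "Q' = y' ` {0..}"
    using periodic_orbit_through[OF assms(2,4)] by metis
  have "y t = y' t" if "t \<ge> 0" for t
    by (rule ode_solution_on_unique[OF y(1) y'(1) _ lip _ _ that]) (use y y' K in auto)
  then show ?thesis using y(3) y'(3) by auto
qed

subsection \<open>Periodic functions\<close>

lemma periodic_2pi_of_int:
  assumes "\<And>s. Q (s + 2 * pi) = Q s"
  shows "Q (s + 2 * pi * of_int n) = Q s"
proof -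
  interpret periodic_fun_simple Q "2 * pi"
    by unfold_locales (rule assms)
  show ?thesis using plus_of_int[of s n] by (simp add: mult.commute)
qed

lemma periodic_2pi_cong:
  assumes "\<And>s. Q (s + 2 * pi) = Q s" "cos s = cos t" "sin s = sin t"
  shows "Q s = Q t"
proof -
  obtain n :: int where "s = t + 2 * pi * n"
    using assms(2,3) sin_cos_eq_iff[of s t] by auto
  then show ?thesis using periodic_2pi_of_int[of Q t n, OF assms(1)] by simp
qed

lemma periodic_2pi_range:
  assumes per: "\<And>s. Q (s + 2 * pi) = Q s"
  shows "range Q = Q ` {0..2 * pi}"
proof -
  have "Q t \<in> Q ` {0..2 * pi}" for t
  proof -
    define n where "n = \<lfloor>t / (2 * pi)\<rfloor>"
    have "n \<le> t / (2 * pi)" "t / (2 * pi) \<le> n + 1"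
      unfolding n_def by linarith+
    then have "t - 2 * pi * n \<in> {0..2 * pi}"
      by (simp add: field_simps)
    moreover have "Q (t - 2 * pi * n) = Q t"
      using periodic_2pi_of_int[of Q "t - 2 * pi * n" n, OF per] by simp
    ultimately show ?thesis by (metis imageI)
  qed
  then show ?thesis by auto
qed

lemma periodic_2pi_attains_max:
  fixes Q :: "real \<Rightarrow> real"
  assumes per: "\<And>s. Q (s + 2 * pi) = Q s" and "continuous_on UNIV Q"
  obtains s where "\<And>t. Q t \<le> Q s"
proof -
  have "continuous_on {0..2 * pi} Q" using assms(2) continuous_on_subset by blast
  then obtain s where "\<forall>t\<in>{0..2 * pi}. Q t \<le> Q s"
    using continuous_attains_sup[of "{0..2 * pi}" Q] by auto
  then have "\<forall>v\<in>range Q. v \<le> Q s"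
    unfolding periodic_2pi_range[of Q, OF per] by blast
  then show thesis using that by blast
qed

text \<open>At a maximum of \<open>(y s)\<^sup>2\<close> either \<open>y'\<close> vanishes, where
  \<open>crit\<close> applies, or \<open>y\<close> vanishes, where \<open>M \<ge> 0\<close>
  suffices.\<close>

lemma periodic_2pi_critical_point_bound:
  fixes y y' :: "real \<Rightarrow> real"
  assumes per: "\<And>s. y (s + 2 * pi) = y s"
    and der: "\<And>s. (y has_real_derivative y' s) (at s)"
    and crit: "\<And>s. y' s = 0 \<Longrightarrow> \<bar>y s\<bar> \<le> M" and "M \<ge> 0"
  shows "\<bar>y s\<bar> \<le> M"
proof -
  have d2: "((\<lambda>s. (y s)\<^sup>2) has_real_derivative 2 * y s * y' s) (at s)" for s
    by (auto intro!: derivative_eq_intros der)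
  have "continuous_on UNIV (\<lambda>s. (y s)\<^sup>2)"
    by (rule DERIV_continuous_on[OF d2])
  then obtain m where m: "\<And>t. (y t)\<^sup>2 \<le> (y m)\<^sup>2"
    using periodic_2pi_attains_max[of "\<lambda>s. (y s)\<^sup>2"] per by metis
  have "2 * y m * y' m = 0"
    by (rule DERIV_local_max[OF d2, of 1 m]) (use m in auto)
  then have "\<bar>y m\<bar> \<le> M"
    using crit[of m] \<open>M \<ge> 0\<close> by auto
  then show ?thesis using m[of s] by (simp add: abs_le_square_iff[symmetric])
qed

text \<open>The periodic inverse of \<open>y' + k * y\<close> has sup norm at most
  \<open>1 / \<bar>k\<bar>\<close> for either sign of \<open>k\<close>: at a critical point
  \<open>k * y = u\<close>.\<close>

lemma periodic_2pi_linear_bound: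
  fixes y :: "real \<Rightarrow> real"
  assumes per: "\<And>s. y (s + 2 * pi) = y s"
    and der: "\<And>s. (y has_real_derivative u s - k * y s) (at s)"
    and u: "\<And>s. \<bar>u s\<bar> \<le> \<bar>k\<bar> * M" and "k \<noteq> 0"
  shows "\<bar>y s\<bar> \<le> M"
proof (rule periodic_2pi_critical_point_bound[OF per der])
  have "0 \<le> \<bar>k\<bar> * M" using u[of 0] by linarith
  then show "M \<ge> 0" using \<open>k \<noteq> 0\<close> by (simp add: zero_le_mult_iff)
  fix s assume "u s - k * y s = 0"
  then have "\<bar>k\<bar> * \<bar>y s\<bar> \<le> \<bar>k\<bar> * M" using u[of s] by (simp add: abs_mult)
  then show "\<bar>y s\<bar> \<le> M" using \<open>k \<noteq> 0\<close> by simp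
qed

lemma antiderivative_exists:
  fixes f :: "real \<Rightarrow> real"
  assumes "continuous_on UNIV f"
  obtains G where "\<And>s. (G has_real_derivative f s) (at s)"
proof -
  have "\<exists>G. \<forall>x::real. -\<infinity> < ereal x \<longrightarrow> ereal x < \<infinity> \<longrightarrow> (G has_vector_derivative f x) (at x)"
    by (rule einterval_antiderivative)
       (use assms in \<open>auto simp: continuous_on_eq_continuous_at\<close>)
  then show thesis
    using that by (auto simp: has_real_derivative_iff_has_vector_derivative)
qed

lemma DERIV_zero_imp_eq:
  fixes f :: "real \<Rightarrow> real"
  assumes "\<And>s. (f has_real_derivative 0) (at s)"
  shows "f s = f t"
  using DERIV_isconst_all[of f s t] assms by blast

text \<open>Variation of constants over one period. The initial value can be adjusted to close the
  solution up because \<open>E \<noteq> 1\<close>, that is, the homogeneous equation has no nonzero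
  periodic solution.\<close>

lemma periodic_2pi_linear_solution:
  fixes u :: "real \<Rightarrow> real"
  assumes per: "\<And>s. u (s + 2 * pi) = u s" and cont: "continuous_on UNIV u" and "k \<noteq> 0"
  shows "\<exists>y. (\<forall>s. y (s + 2 * pi) = y s) \<and> (\<forall>s. (y has_real_derivative u s - k * y s) (at s))"
proof -
  have "continuous_on UNIV (\<lambda>s. exp (k * s) * u s)"
    by (intro continuous_intros cont)
  then obtain G where G: "\<And>s. (G has_real_derivative exp (k * s) * u s) (at s)"
    by (rule antiderivative_exists) blast
  define E where "E = exp (k * (2 * pi))"
  have E: "E \<noteq> 1" using \<open>k \<noteq> 0\<close> by (simp add: E_def)
  have G': "((\<lambda>s. G (s + 2 * pi)) has_real_derivative E * (exp (k * s) * u s)) (at s)" for s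
  proof -
    have "exp (k * (s + 2 * pi)) = E * exp (k * s)"
      by (simp add: E_def exp_add[symmetric] distrib_left)
    then have "exp (k * (s + 2 * pi)) * u (s + 2 * pi) = E * (exp (k * s) * u s)"
      by (simp only: per mult.assoc)
    with G[of "s + 2 * pi"] show ?thesis by (simp add: DERIV_shift)
  qed
  define y where "y s = exp (- k * s) * (G (s + 2 * pi) - G s) / (E - 1)" for s
  have "y (s + 2 * pi) = y s" for s
  proof -
    have "((\<lambda>s. G (s + 2 * pi) - E * G s) has_real_derivative 0) (at s)" for s
      by (rule derivative_eq_intros G' G refl | simp)+
    then have "G (s + 2 * pi + 2 * pi) - E * G (s + 2 * pi) = G (s + 2 * pi) - E * G s"
      by (rule DERIV_zero_imp_eq)
    then have "G (s + 2 * pi + 2 * pi) - G (s + 2 * pi) = E * (G (s + 2 * pi) - G s)"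
      by (simp add: algebra_simps)
    moreover have "exp (- k * (s + 2 * pi)) = exp (- k * s) / E"
      by (simp add: E_def exp_diff[symmetric] algebra_simps)
    ultimately show ?thesis unfolding y_def by (simp add: E_def)
  qed
  moreover have "(y has_real_derivative u s - k * y s) (at s)" for s
  proof -
    have "(y has_real_derivative
        (exp (- k * s) * (E * (exp (k * s) * u s) - exp (k * s) * u s)
          + (- k * exp (- k * s)) * (G (s + 2 * pi) - G s)) / (E - 1)) (at s)"
      unfolding y_def by (rule DERIV_cdivide, (rule derivative_eq_intros G' G refl | simp)+)
    moreover have "exp (- k * s) * (E * (exp (k * s) * u s) - exp (k * s) * u s)
        = (E - 1) * u s * (exp (- k * s) * exp (k * s))"
      by (simp only: left_diff_distrib right_diff_distrib mult_ac)
    moreover have "exp (- k * s) * exp (k * s) = 1"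
      by (simp add: exp_add[symmetric])
    moreover have "((E - 1) * u s * 1 + (- k * exp (- k * s)) * (G (s + 2 * pi) - G s)) / (E - 1)
        = u s - k * y s"
      using E by (simp add: y_def diff_divide_distrib)
    ultimately show ?thesis by (simp only:)
  qed
  ultimately show ?thesis by blast
qed

text \<open>Fixed point of the map sending \<open>y\<close> to a periodic solution \<open>z\<close>
  of \<open>z' = h s (y s) - k * z\<close>. As the linear inverse has norm
  \<open>1 / \<bar>k\<bar>\<close>, \<open>bd\<close> makes it a self-map of the ball of radius
  \<open>R\<close> and \<open>lip\<close> a contraction by \<open>1/2\<close>. Hypotheses on
  \<open>h\<close> are confined to \<open>\<bar>v\<bar> \<le> R\<close> because the intended
  \<open>h\<close> has a denominator that may vanish outside.\<close>

lemma periodic_2pi_solution_exists: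
  fixes h :: "real \<Rightarrow> real \<Rightarrow> real"
  assumes "k \<noteq> 0" and "R \<ge> 0"
    and cont: "\<And>y. continuous_on UNIV y \<Longrightarrow> (\<And>s. \<bar>y s\<bar> \<le> R) \<Longrightarrow> continuous_on UNIV (\<lambda>s. h s (y s))"
    and per: "\<And>s v. h (s + 2 * pi) v = h s v"
    and bd: "\<And>s v. \<bar>v\<bar> \<le> R \<Longrightarrow> \<bar>h s v\<bar> \<le> \<bar>k\<bar> * R"
    and lip: "\<And>s v w. \<bar>v\<bar> \<le> R \<Longrightarrow> \<bar>w\<bar> \<le> R \<Longrightarrow> \<bar>h s v - h s w\<bar> \<le> \<bar>k\<bar> / 2 * \<bar>v - w\<bar>"
  shows "\<exists>y. (\<forall>s. y (s + 2 * pi) = y s) \<and> (\<forall>s. \<bar>y s\<bar> \<le> R)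
      \<and> (\<forall>s. (y has_real_derivative h s (y s) - k * y s) (at s))"
proof -
  define S where "S = {y :: real \<Rightarrow>\<^sub>C real. (\<forall>s. apply_bcontfun y (s + 2 * pi) = apply_bcontfun y s)
      \<and> (\<forall>s. \<bar>apply_bcontfun y s\<bar> \<le> R)}"
  have ev: "continuous_on UNIV (\<lambda>y :: real \<Rightarrow>\<^sub>C real. apply_bcontfun y s)" for s
    by (rule lipschitz_on_continuous_on[of 1], rule lipschitz_onI) (auto intro: dist_bounded)
  have "closed S"
    unfolding S_def
    by (intro closed_Collect_conj closed_Collect_all closed_Collect_eq closed_Collect_le
        continuous_intros ev)
  then have "complete S" by (simp add: complete_eq_closed)
  moreover have "0 \<in> S" using \<open>R \<ge> 0\<close> by (simp add: S_def)
  then have "S \<noteq> {}" by blast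
  define sol where "sol y z \<longleftrightarrow> (\<forall>s. z (s + 2 * pi) = z s) \<and>
     (\<forall>s. (z has_real_derivative h s (apply_bcontfun y s) - k * z s) (at s))" for y z
  \<comment> \<open>An arbitrary choice is harmless: the bounds below use only the differential
    equation and periodicity of the chosen function.\<close>
  define T where "T y = Bcontfun (SOME z. sol y z)" for y
  have T: "sol y (apply_bcontfun (T y)) \<and> T y \<in> S" if "y \<in> S" for y
  proof -
    have "\<exists>z. sol y z"
      unfolding sol_def
      by (rule periodic_2pi_linear_solution[OF _ cont \<open>k \<noteq> 0\<close>])
         (use that per in \<open>auto simp: S_def\<close>)
    then have z: "sol y (SOME z. sol y z)" (is "sol y ?z") by (rule someI_ex)
    have zb: "\<bar>?z s\<bar> \<le> R" for s
      by (rule periodic_2pi_linear_bound[where y = "?z" and k = k and u = "\<lambda>s. h s (apply_bcontfun y s)"])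
         (use z that bd \<open>k \<noteq> 0\<close> in \<open>auto simp: sol_def S_def\<close>)
    have "continuous_on UNIV ?z"
      by (rule DERIV_continuous_on[where D = "\<lambda>s. h s (apply_bcontfun y s) - k * ?z s"])
         (use z in \<open>simp add: sol_def\<close>)
    then have "?z \<in> bcontfun" using zb by (intro bcontfun_normI[of _ R]) auto
    then have "apply_bcontfun (T y) = ?z" by (simp add: T_def Bcontfun_inverse)
    with z zb show ?thesis by (auto simp: S_def sol_def)
  qed
  have "\<exists>!y\<in>S. T y = y"
  proof (rule Banach_fix[of S "1/2"])
    fix y z assume yz: "y \<in> S" "z \<in> S"
    have "\<bar>apply_bcontfun (T y) s - apply_bcontfun (T z) s\<bar> \<le> dist y z / 2" for s
    proof (rule periodic_2pi_linear_bound[where k = k and M = "dist y z / 2"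
          and y = "\<lambda>s. apply_bcontfun (T y) s - apply_bcontfun (T z) s"
          and u = "\<lambda>s. h s (apply_bcontfun y s) - h s (apply_bcontfun z s)"])
      fix s
      show "((\<lambda>s. apply_bcontfun (T y) s - apply_bcontfun (T z) s) has_real_derivative
         h s (apply_bcontfun y s) - h s (apply_bcontfun z s)
          - k * (apply_bcontfun (T y) s - apply_bcontfun (T z) s)) (at s)"
        using T[OF yz(1)] T[OF yz(2)] unfolding sol_def
        by (auto intro!: derivative_eq_intros simp: algebra_simps)
      have "\<bar>h s (apply_bcontfun y s) - h s (apply_bcontfun z s)\<bar>
          \<le> \<bar>k\<bar> / 2 * \<bar>apply_bcontfun y s - apply_bcontfun z s\<bar>"
        using yz by (intro lip) (auto simp: S_def)
      also have "\<dots> \<le> \<bar>k\<bar> / 2 * dist y z"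
        using dist_bounded[of y s z] by (intro mult_left_mono) (auto simp: dist_real_def)
      finally show "\<bar>h s (apply_bcontfun y s) - h s (apply_bcontfun z s)\<bar> \<le> \<bar>k\<bar> * (dist y z / 2)"
        by simp
    qed (use T[OF yz(1)] T[OF yz(2)] \<open>k \<noteq> 0\<close> in \<open>auto simp: sol_def\<close>)
    then show "dist (T y) (T z) \<le> 1 / 2 * dist y z"
      by (intro dist_bound) (simp add: dist_real_def)
  qed (use T \<open>complete S\<close> \<open>S \<noteq> {}\<close> in auto)
  then obtain y where "y \<in> S" "T y = y" by blast
  then show ?thesis using T[of y] by (auto simp: S_def sol_def)
qed

section \<open>Periodic functions of the polar angle\<close>

definition angle :: "real \<times> real \<Rightarrow> real"
  where "angle p = Arg (Complex (fst p) (snd p))"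

lemma polar_angle:
  "p = (norm p * cos (angle p), norm p * sin (angle p))"
proof -
  have "Complex (fst p) (snd p) = rcis (norm p) (angle p)"
    using rcis_cmod_Arg[of "Complex (fst p) (snd p)"]
    by (simp add: angle_def norm_prod_def cmod_def)
  then show ?thesis
    by (metis Re_rcis Im_rcis complex.sel prod.collapse)
qed

lemma periodic_2pi_angle_polar:
  assumes "\<And>s. Q (s + 2 * pi) = Q s" and "r > 0"
  shows "Q (angle (r * cos t, r * sin t)) = Q t"
proof -
  define p where "p = (r * cos t, r * sin t)"
  have "norm p = r"
    using \<open>r > 0\<close>
    by (simp add: p_def norm_prod_def power_mult_distrib distrib_left[symmetric] real_sqrt_mult)
  then have "r * cos (angle p) = r * cos t" "r * sin (angle p) = r * sin t"
    using polar_angle[of p] by (auto simp: p_def)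
  then have "cos (angle p) = cos t" "sin (angle p) = sin t"
    using \<open>r > 0\<close> by simp_all
  then have "Q (angle p) = Q t"
    by (rule periodic_2pi_cong[of Q, OF assms(1)])
  then show ?thesis by (simp add: p_def)
qed

text \<open>The scaling \<open>c\<close> will be 1 or -1, the latter moving points on the branch cut
  off it. It cancels in the derivative, which is the usual form (v dw - w dv) / r^2 of the
  angle.\<close>

lemma Im_Ln_has_derivative:
  fixes p :: "real \<times> real"
  assumes "c \<noteq> 0" "Complex (c * fst p) (c * snd p) \<notin> \<real>\<^sub>\<le>\<^sub>0"
  shows "((\<lambda>p. Im (Ln (Complex (c * fst p) (c * snd p)))) has_derivative
     (\<lambda>h. (fst p * snd h - snd p * fst h) / (norm p)\<^sup>2)) (at p)"
proof -
  define l where "l p = Complex (c * fst p) (c * snd p)" for p :: "real \<times> real"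
  have l_eq: "l p = of_real (c * fst p) + of_real (c * snd p) * \<i>" for p
    by (simp add: l_def complex_eq_iff)
  have l: "(l has_derivative l) (at p)"
    unfolding l_eq[abs_def] by (auto intro!: derivative_eq_intros)
  have "(Ln has_derivative (\<lambda>h. inverse (l p) * h)) (at (l p))"
    using has_field_derivative_Ln[of "l p"] assms(2) by (simp add: has_field_derivative_def l_def)
  from has_derivative_compose[OF l this]
  have "((\<lambda>p. Im (Ln (l p))) has_derivative (\<lambda>h. Im (inverse (l p) * l h))) (at p)"
    by (rule has_derivative_Im)
  moreover have "Im (inverse (l p) * l h) = (fst p * snd h - snd p * fst h) / (norm p)\<^sup>2" for h
  proof -
    have "Im (inverse (l p) * l h) = Im (l h / l p)"
      by (simp add: divide_inverse mult.commute)
    also have "\<dots> = (c\<^sup>2 * (fst p * snd h - snd p * fst h)) / (c\<^sup>2 * ((fst p)\<^sup>2 + (snd p)\<^sup>2))"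
      unfolding Im_divide by (simp add: l_def power_mult_distrib power2_eq_square algebra_simps)
    also have "\<dots> = (fst p * snd h - snd p * fst h) / ((fst p)\<^sup>2 + (snd p)\<^sup>2)"
      using \<open>c \<noteq> 0\<close> by (intro mult_divide_mult_cancel_left) simp
    finally show ?thesis by (simp add: norm_prod_def)
  qed
  ultimately show ?thesis by (simp add: l_def)
qed

text \<open>The branch cut of \<^const>\<open>Arg\<close> is invisible to a periodic function: on the cut,
  \<^const>\<open>angle\<close> may be replaced by the angle of the antipode plus \<^term>\<open>pi\<close>.\<close>

lemma periodic_2pi_angle_has_derivative:
  fixes Q :: "real \<Rightarrow> real" and p :: "real \<times> real"
  assumes per: "\<And>s. Q (s + 2 * pi) = Q s"
    and der: "\<And>s. (Q has_real_derivative Q' s) (at s)" and "p \<noteq> 0"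
  shows "((\<lambda>p. Q (angle p)) has_derivative
     (\<lambda>h. Q' (angle p) * ((fst p * snd h - snd p * fst h) / (norm p)\<^sup>2))) (at p)"
proof -
  \<comment> \<open>The chain rule yields \<open>Q'\<close> at a local smooth angle, and periodicity
    of \<open>Q'\<close> brings it back to \<open>angle p\<close>.\<close>
  have per': "Q' (s + 2 * pi) = Q' s" for s
  proof (rule DERIV_unique[OF _ der])
    have "((\<lambda>s. Q (s + 2 * pi)) has_real_derivative Q' (s + 2 * pi)) (at s)"
      using DERIV_shift[of Q "Q' (s + 2 * pi)" s "2 * pi"] der by simp
    then show "(Q has_real_derivative Q' (s + 2 * pi)) (at s)" by (simp add: per)
  qed
  have L: "cos (Im (Ln z)) = Re z / cmod z" "sin (Im (Ln z)) = Im z / cmod z" if "z \<noteq> 0" for z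
    using that by (simp_all add: Arg_eq_Im_Ln[symmetric] cos_Arg sin_Arg)
  have A: "cos (angle q) = fst q / norm q" "sin (angle q) = snd q / norm q" if "q \<noteq> 0" for q
    using polar_angle[of q] that by (metis fst_conv snd_conv norm_eq_zero nonzero_mult_div_cancel_left)+
  obtain c d where cd: "c \<noteq> 0" "Complex (c * fst p) (c * snd p) \<notin> \<real>\<^sub>\<le>\<^sub>0"
    and ang: "\<And>q. q \<noteq> 0 \<Longrightarrow> cos (angle q) = cos (Im (Ln (Complex (c * fst q) (c * snd q))) + d) \<and>
        sin (angle q) = sin (Im (Ln (Complex (c * fst q) (c * snd q))) + d)"
  proof (cases "Complex (fst p) (snd p) \<in> \<real>\<^sub>\<le>\<^sub>0")
    case False
    have "cos (angle q) = cos (Im (Ln (Complex (1 * fst q) (1 * snd q))) + 0) \<and>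
        sin (angle q) = sin (Im (Ln (Complex (1 * fst q) (1 * snd q))) + 0)" if "q \<noteq> 0" for q
      using that L[of "Complex (fst q) (snd q)"] A[OF that]
      by (auto simp: complex_eq_iff prod_eq_iff norm_prod_def cmod_def)
    then show thesis by (intro that[of 1 0]) (use False in simp_all)
  next
    case True
    have "cos (angle q) = cos (Im (Ln (Complex ((-1) * fst q) ((-1) * snd q))) + pi) \<and>
        sin (angle q) = sin (Im (Ln (Complex ((-1) * fst q) ((-1) * snd q))) + pi)" if "q \<noteq> 0" for q
      using that L[of "Complex (- fst q) (- snd q)"] A[OF that]
      by (auto simp: complex_eq_iff prod_eq_iff norm_prod_def cmod_def)
    moreover have "Complex ((-1) * fst p) ((-1) * snd p) \<notin> \<real>\<^sub>\<le>\<^sub>0"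
      using True \<open>p \<noteq> 0\<close> by (auto simp: complex_nonpos_Reals_iff prod_eq_iff)
    ultimately show thesis by (intro that[of "-1" pi]) simp_all
  qed
  define a where "a q = Im (Ln (Complex (c * fst q) (c * snd q))) + d" for q
  have Q_eq: "Q (angle q) = Q (a q)" "Q' (angle q) = Q' (a q)" if "q \<noteq> 0" for q
    using ang[OF that] periodic_2pi_cong[of Q, OF per] periodic_2pi_cong[of Q', OF per']
    unfolding a_def by blast+
  have "(a has_derivative (\<lambda>h. (fst p * snd h - snd p * fst h) / (norm p)\<^sup>2)) (at p)"
    unfolding a_def using has_derivative_add[OF Im_Ln_has_derivative[OF cd] has_derivative_const]
    by simp
  from has_derivative_compose[OF this der[unfolded has_field_derivative_def]]
  have "((\<lambda>q. Q (a q)) has_derivative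
     (\<lambda>h. Q' (a p) * ((fst p * snd h - snd p * fst h) / (norm p)\<^sup>2))) (at p)"
    by simp
  then show ?thesis
    unfolding Q_eq(2)[OF \<open>p \<noteq> 0\<close>]
    by (rule has_derivative_transform_within_open[of _ _ _ _ "- {0}"])
       (use \<open>p \<noteq> 0\<close> Q_eq in auto)
qed

text \<open>A slope bounded below makes \<open>S\<close> a bijection of the line, and its inverse is
  Lipschitz with constant \<open>1 / c\<close>, hence continuous, as the inverse function rule
  requires. It serves to change from the polar angle to time as parameter of the periodic
  orbit.\<close>

lemma increasing_inverse_exists:
  fixes S S' :: "real \<Rightarrow> real"
  assumes der: "\<And>s. (S has_real_derivative S' s) (at s)"
    and ge: "\<And>s. S' s \<ge> c" and "c > 0"
  obtains \<theta> where "\<And>t. S (\<theta> t) = t" "\<And>s. \<theta> (S s) = s"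
    "\<And>t. (\<theta> has_real_derivative inverse (S' (\<theta> t))) (at t)"
proof -
  have grow: "S t - S s \<ge> c * (t - s)" if "s \<le> t" for s t
  proof -
    have "S s - c * s \<le> S t - c * t"
    proof (rule DERIV_nonneg_imp_nondecreasing[OF that])
      fix x
      have "((\<lambda>s. S s - c * s) has_real_derivative S' x - c) (at x)"
        by (auto intro!: derivative_eq_intros der)
      then show "\<exists>y. ((\<lambda>s. S s - c * s) has_real_derivative y) (at x) \<and> 0 \<le> y"
        using ge[of x] by auto
    qed
    then show ?thesis by (simp add: algebra_simps)
  qed
  have cont: "continuous_on X S" for X
    by (meson DERIV_continuous_on DERIV_subset der subset_UNIV)
  have inj: "s = t" if "S s = S t" for s t
    using grow[of s t] grow[of t s] that mult_pos_pos[OF \<open>c > 0\<close>, of "t - s"]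
      mult_pos_pos[OF \<open>c > 0\<close>, of "s - t"]
    by (cases s t rule: linorder_cases) auto
  have "\<exists>s. S s = t" for t
  proof -
    define b where "b = \<bar>t - S 0\<bar> / c"
    have b: "b \<ge> 0" "c * b = \<bar>t - S 0\<bar>" using \<open>c > 0\<close> by (auto simp: b_def)
    have "S (- b) \<le> t" "t \<le> S b" using grow[of "-b" 0] grow[of 0 b] b by auto
    then show ?thesis using IVT'[of S "-b" t b] b cont by auto
  qed
  then obtain \<theta> where \<theta>: "\<And>t. S (\<theta> t) = t" by metis
  have lip: "c * \<bar>\<theta> t - \<theta> u\<bar> \<le> \<bar>t - u\<bar>" for t u
    using grow[of "\<theta> t" "\<theta> u"] grow[of "\<theta> u" "\<theta> t"] \<theta>[of t] \<theta>[of u]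
    by (cases "\<theta> t \<le> \<theta> u") (auto simp: abs_if)
  have "(1 / c)-lipschitz_on UNIV \<theta>"
    by (rule lipschitz_onI) (use lip \<open>c > 0\<close> in \<open>auto simp: dist_real_def field_simps\<close>)
  then have "isCont \<theta> t" for t
    using lipschitz_on_continuous_on continuous_on_eq_continuous_at open_UNIV by blast
  then have "(\<theta> has_real_derivative inverse (S' (\<theta> t))) (at t)" for t
    by (rule DERIV_inverse_function[OF der, of _ _ "t - 1" "t + 1", rotated -1])
       (use ge[of "\<theta> t"] \<open>c > 0\<close> \<theta> in auto)
  then show thesis using that \<theta> inj by blast
qed

subsection \<open>Lipschitz continuity\<close>

text \<open>Boundedness is carried along because it is what makes the Lipschitz functions on a set
  closed under products.\<close>

definition lipschitz_bounded :: "'a::real_normed_vector set \<Rightarrow> ('a \<Rightarrow> real) \<Rightarrow> bool"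
  where "lipschitz_bounded S h \<longleftrightarrow> (\<exists>L. L-lipschitz_on S h) \<and> (\<exists>K. \<forall>p\<in>S. \<bar>h p\<bar> \<le> K)"

lemma lipschitz_bounded_const: "lipschitz_bounded S (\<lambda>_. c)"
  unfolding lipschitz_bounded_def by (auto intro: lipschitz_on_constant)

lemma lipschitz_bounded_add:
  assumes "lipschitz_bounded S h1" "lipschitz_bounded S h2"
  shows "lipschitz_bounded S (\<lambda>p. h1 p + h2 p)"
proof -
  obtain L1 K1 L2 K2 where "L1-lipschitz_on S h1" "\<forall>p\<in>S. \<bar>h1 p\<bar> \<le> K1"
    "L2-lipschitz_on S h2" "\<forall>p\<in>S. \<bar>h2 p\<bar> \<le> K2"
    using assms unfolding lipschitz_bounded_def by blast
  then show ?thesis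
    unfolding lipschitz_bounded_def
    by (intro conjI exI[of _ "L1 + L2"] exI[of _ "K1 + K2"] lipschitz_on_add ballI
        order_trans[OF abs_triangle_ineq] add_mono) auto
qed

lemma lipschitz_bounded_mult:
  assumes "lipschitz_bounded S h1" "lipschitz_bounded S h2"
  shows "lipschitz_bounded S (\<lambda>p. h1 p * h2 p)"
proof -
  obtain L1 K1 L2 K2 where h: "L1-lipschitz_on S h1" "\<forall>p\<in>S. \<bar>h1 p\<bar> \<le> K1"
    "L2-lipschitz_on S h2" "\<forall>p\<in>S. \<bar>h2 p\<bar> \<le> K2"
    using assms unfolding lipschitz_bounded_def by blast
  have L: "L1 \<ge> 0" "L2 \<ge> 0" using h lipschitz_on_nonneg by blast+
  have "(\<bar>K1\<bar> * L2 + \<bar>K2\<bar> * L1)-lipschitz_on S (\<lambda>p. h1 p * h2 p)"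
  proof (rule lipschitz_onI)
    fix p q assume pq: "p \<in> S" "q \<in> S"
    have "\<bar>h1 p * h2 p - h1 q * h2 q\<bar> = \<bar>h1 p * (h2 p - h2 q) + h2 q * (h1 p - h1 q)\<bar>"
      by (simp add: algebra_simps)
    also have "\<dots> \<le> \<bar>h1 p\<bar> * \<bar>h2 p - h2 q\<bar> + \<bar>h2 q\<bar> * \<bar>h1 p - h1 q\<bar>"
      by (rule order_trans[OF abs_triangle_ineq]) (simp add: abs_mult)
    also have "\<dots> \<le> \<bar>K1\<bar> * (L2 * dist p q) + \<bar>K2\<bar> * (L1 * dist p q)"
      using h pq lipschitz_onD[OF h(1) pq] lipschitz_onD[OF h(3) pq] L
      by (intro add_mono mult_mono) (force simp: dist_real_def)+
    finally show "dist (h1 p * h2 p) (h1 q * h2 q) \<le> (\<bar>K1\<bar> * L2 + \<bar>K2\<bar> * L1) * dist p q"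
      by (simp add: dist_real_def algebra_simps)
  qed (use L in auto)
  moreover have "\<forall>p\<in>S. \<bar>h1 p * h2 p\<bar> \<le> \<bar>K1\<bar> * \<bar>K2\<bar>"
    using h by (fastforce simp: abs_mult intro!: mult_mono)
  ultimately show ?thesis unfolding lipschitz_bounded_def by blast
qed

lemma lipschitz_bounded_diff:
  assumes "lipschitz_bounded S h1" "lipschitz_bounded S h2"
  shows "lipschitz_bounded S (\<lambda>p. h1 p - h2 p)"
  using lipschitz_bounded_add[OF assms(1) lipschitz_bounded_mult[OF lipschitz_bounded_const[of S "-1"] assms(2)]]
  by simp

lemma lipschitz_bounded_abs:
  assumes "lipschitz_bounded S h"
  shows "lipschitz_bounded S (\<lambda>p. \<bar>h p\<bar>)"
proof -
  obtain L K where h: "L-lipschitz_on S h" "\<forall>p\<in>S. \<bar>h p\<bar> \<le> K"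
    using assms unfolding lipschitz_bounded_def by blast
  have "L-lipschitz_on S (\<lambda>p. \<bar>h p\<bar>)"
  proof (rule lipschitz_onI)
    fix p q assume "p \<in> S" "q \<in> S"
    then show "dist \<bar>h p\<bar> \<bar>h q\<bar> \<le> L * dist p q"
      using lipschitz_onD[OF h(1), of p q] by (simp add: dist_real_def)
  qed (use h lipschitz_on_nonneg in blast)
  with h show ?thesis unfolding lipschitz_bounded_def by auto
qed

lemma lipschitz_bounded_fst: "lipschitz_bounded (cball 0 R) (fst :: real \<times> real \<Rightarrow> real)"
proof -
  have "1-lipschitz_on (cball 0 R) (fst :: real \<times> real \<Rightarrow> real)"
    by (rule lipschitz_onI) (auto simp: dist_fst_le)
  moreover have "\<bar>fst p\<bar> \<le> R" if "p \<in> cball 0 R" for p :: "real \<times> real"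
    using that norm_fst_le[of "fst p" "snd p"] by simp
  ultimately show ?thesis unfolding lipschitz_bounded_def by blast
qed

lemma lipschitz_bounded_snd: "lipschitz_bounded (cball 0 R) (snd :: real \<times> real \<Rightarrow> real)"
proof -
  have "1-lipschitz_on (cball 0 R) (snd :: real \<times> real \<Rightarrow> real)"
    by (rule lipschitz_onI) (auto simp: dist_snd_le)
  moreover have "\<bar>snd p\<bar> \<le> R" if "p \<in> cball 0 R" for p :: "real \<times> real"
    using that norm_snd_le[of "snd p" "fst p"] by simp
  ultimately show ?thesis unfolding lipschitz_bounded_def by blast
qed

subsection \<open>The system in polar coordinates\<close>

locale piecewise_quadratic_system =
  fixes \<omega> a11 a12 a21 a22 b11 b12 b21 b22 \<sigma> :: real
    and f g :: "real \<Rightarrow> real \<Rightarrow> real"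
  assumes omega: "\<omega> \<noteq> 0"
    and f_eq: "\<And>v w. f v w = a11 * v * \<bar>v\<bar> + a12 * v * \<bar>w\<bar> + a21 * w * \<bar>v\<bar> + a22 * w * \<bar>w\<bar>"
    and g_eq: "\<And>v w. g v w = b11 * v * \<bar>v\<bar> + b12 * v * \<bar>w\<bar> + b21 * w * \<bar>v\<bar> + b22 * w * \<bar>w\<bar>"
    and sigma_eq: "\<sigma> = 2 * a11 + a12 + b21 + 2 * b22"
    and sigma: "\<sigma> \<noteq> 0"
begin

abbreviation F where "F \<equiv> planar_system \<omega> f g"

text \<open>\<open>Am\<close> is the mean value of \<open>A\<close>.\<close>

definition A where "A s = cos s * f (cos s) (sin s) + sin s * g (cos s) (sin s)"
definition B where "B s = cos s * g (cos s) (sin s) - sin s * f (cos s) (sin s)"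
definition Am where "Am = 2 * \<sigma> / (3 * pi)"
definition M where "M = 1 + (\<bar>a11\<bar> + \<bar>a12\<bar> + \<bar>a21\<bar> + \<bar>a22\<bar>) + (\<bar>b11\<bar> + \<bar>b12\<bar> + \<bar>b21\<bar> + \<bar>b22\<bar>)"
text \<open>The extra multiple of \<open>\<bar>Am\<bar>\<close> lets \<open>C\<close> bound both
  \<open>A s - Am\<close> and, along a profile, \<open>\<mu> * P s + A s\<close>.\<close>

definition C where "C = M + 2 * \<bar>Am\<bar>"
text \<open>Solves \<open>(2 * C / \<bar>\<omega>\<bar>) * M * \<delta> * (2 * \<bar>\<mu>\<bar> /
  \<bar>Am\<bar>) = \<bar>\<mu>\<bar> / 2\<close>, where the left side is the product of the bounds
  for the slope, \<open>B\<close>, the radius and \<open>1 / P\<close>; \<open>\<mu>\<close>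
  cancels.\<close>

definition \<delta> where "\<delta> = \<bar>\<omega>\<bar> * \<bar>Am\<bar> / (8 * C * M)"

lemma A_periodic: "A (s + 2 * pi) = A s" and B_periodic: "B (s + 2 * pi) = B s"
  by (simp_all add: A_def B_def)

lemma continuous_on_A: "continuous_on S A" and continuous_on_B: "continuous_on S B"
  unfolding A_def[abs_def] B_def[abs_def] f_eq g_eq by (intro continuous_intros)+

lemma Am: "Am \<noteq> 0" using sigma by (simp add: Am_def)

lemma M: "M \<ge> 1" unfolding M_def by linarith

lemma C: "C > 0" "C \<ge> M + \<bar>Am\<bar>" using M unfolding C_def by auto

lemma delta: "\<delta> > 0" using omega Am C M unfolding \<delta>_def by auto

lemma A_bound: "\<bar>A s\<bar> \<le> M" and B_bound: "\<bar>B s\<bar> \<le> M"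
proof -
  have t: "\<bar>x * cos s\<bar> \<le> \<bar>x\<bar>" "\<bar>x * sin s\<bar> \<le> \<bar>x\<bar>" for x
    by (simp_all add: abs_mult mult_left_le)
  have p: "\<bar>x * y * z\<bar> \<le> \<bar>x\<bar>" if "\<bar>y\<bar> \<le> 1" "\<bar>z\<bar> \<le> 1" for x y z :: real
  proof -
    have "\<bar>y\<bar> * \<bar>z\<bar> \<le> 1 * 1" using that by (intro mult_mono) auto
    then show ?thesis by (simp add: abs_mult mult.assoc mult_left_le)
  qed
  have ab: "\<bar>x1 + x2 + x3 + x4\<bar> \<le> \<bar>x1\<bar> + \<bar>x2\<bar> + \<bar>x3\<bar> + \<bar>x4\<bar>" for x1 x2 x3 x4 :: real
    by linarith
  have f: "\<bar>f (cos s) (sin s)\<bar> \<le> \<bar>a11\<bar> + \<bar>a12\<bar> + \<bar>a21\<bar> + \<bar>a22\<bar>"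
    unfolding f_eq by (rule order_trans[OF ab]) (intro add_mono p, simp_all)
  have g: "\<bar>g (cos s) (sin s)\<bar> \<le> \<bar>b11\<bar> + \<bar>b12\<bar> + \<bar>b21\<bar> + \<bar>b22\<bar>"
    unfolding g_eq by (rule order_trans[OF ab]) (intro add_mono p, simp_all)
  have "\<bar>A s\<bar> \<le> \<bar>f (cos s) (sin s) * cos s\<bar> + \<bar>g (cos s) (sin s) * sin s\<bar>"
    unfolding A_def by (simp add: mult.commute abs_triangle_ineq)
  also have "\<dots> \<le> \<bar>f (cos s) (sin s)\<bar> + \<bar>g (cos s) (sin s)\<bar>" by (intro add_mono t)
  finally show "\<bar>A s\<bar> \<le> M" using f g unfolding M_def by linarith
  have "\<bar>B s\<bar> \<le> \<bar>g (cos s) (sin s) * cos s\<bar> + \<bar>f (cos s) (sin s) * sin s\<bar>"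
    unfolding B_def by (simp add: mult.commute abs_triangle_ineq4)
  also have "\<dots> \<le> \<bar>g (cos s) (sin s)\<bar> + \<bar>f (cos s) (sin s)\<bar>" by (intro add_mono t)
  finally show "\<bar>B s\<bar> \<le> M" using f g unfolding M_def by linarith
qed

text \<open>The content is that \<open>A\<close> has mean \<open>Am\<close>. Absolute values
  obstruct a direct integration; adding the four shifts of \<open>A\<close> by quarter turns reduces
  the integral to the open first quadrant, where all signs are known and the sum is a trigonometric
  polynomial.\<close>

lemma A_average:
  obtains a K where "\<And>s. a (s + 2 * pi) = a s"
    "\<And>s. (a has_real_derivative (A s - Am) / \<omega>) (at s)" "\<And>s. \<bar>a s\<bar> \<le> K"
proof -
  have "continuous_on UNIV (\<lambda>s. A s - Am)"
    by (intro continuous_intros continuous_on_A)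
  then obtain G where G: "\<And>s. (G has_real_derivative A s - Am) (at s)"
    by (rule antiderivative_exists) blast
  have Gs: "((\<lambda>s. G (s + c)) has_real_derivative A (s + c) - Am) (at s)" for s c
    using G[of "s + c"] by (simp add: DERIV_shift)
  \<comment> \<open>Between 0 and \<open>pi / 2\<close> the sum telescopes: its increment is that of
    \<open>G\<close> over the full period.\<close>
  define H where "H t = G t + G (t + pi / 2) + G (t + pi) + G (t + 3 * pi / 2)" for t
  \<comment> \<open>Antiderivative of the polynomial valid on the first quadrant. The combination
    \<open>a21 + b11 - a22 - b12\<close> has equal values at both ends, so only
    \<open>\<sigma>\<close> survives.\<close>
  define E where "E t = 2 * ((a11 + b22) * (sin t - (sin t)^3 / 3 - cos t + (cos t)^3 / 3)
      + (a12 + b21) * ((sin t)^3 / 3 - (cos t)^3 / 3)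
      - (a21 + b11 - a22 - b12) * ((sin t)^3 / 3 + (cos t)^3 / 3)) - 4 * Am * t" for t
  have H: "(H has_real_derivative
     (A t - Am) + (A (t + pi / 2) - Am) + (A (t + pi) - Am) + (A (t + 3 * pi / 2) - Am)) (at t)" for t
    unfolding H_def by (intro derivative_intros G Gs)
  define E' where "E' t = 2 * ((a11 + b22) * (cos t - (sin t)^2 * cos t + sin t - (cos t)^2 * sin t)
      + (a12 + b21) * ((sin t)^2 * cos t + (cos t)^2 * sin t)
      - (a21 + b11 - a22 - b12) * ((sin t)^2 * cos t - (cos t)^2 * sin t)) - 4 * Am" for t
  have E: "(E has_real_derivative E' t) (at t)" for t
    unfolding E_def E'_def
    by (rule derivative_eq_intros refl | simp add: algebra_simps power2_eq_square)+
  have eq: "(A t - Am) + (A (t + pi / 2) - Am) + (A (t + pi) - Am) + (A (t + 3 * pi / 2) - Am) = E' t"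
    if "0 < t" "t < pi / 2" for t
  proof -
    have pos: "sin t > 0" "cos t > 0" using that by (auto intro: sin_gt_zero cos_gt_zero)
    have sh: "cos (t + pi / 2) = - sin t" "sin (t + pi / 2) = cos t"
       "cos (t + pi) = - cos t" "sin (t + pi) = - sin t"
       "cos (t + 3 * pi / 2) = sin t" "sin (t + 3 * pi / 2) = - cos t"
      using cos_add[of "t + pi" "pi / 2"] sin_add[of "t + pi" "pi / 2"]
      by (simp_all add: sin_add cos_add mult.commute)
    have s2: "sin t ^ 3 = sin t - (cos t)\<^sup>2 * sin t" "cos t ^ 3 = cos t - (sin t)\<^sup>2 * cos t"
    proof -
      have "sin t ^ 3 = (sin t)\<^sup>2 * sin t" "cos t ^ 3 = (cos t)\<^sup>2 * cos t"
        by (simp_all add: power3_eq_cube power2_eq_square)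
      then show "sin t ^ 3 = sin t - (cos t)\<^sup>2 * sin t" "cos t ^ 3 = cos t - (sin t)\<^sup>2 * cos t"
        using sin_squared_eq[of t] cos_squared_eq[of t] by (metis left_diff_distrib mult_1_left)+
    qed
    have "(A t - Am) + (A (t + pi / 2) - Am) + (A (t + pi) - Am) + (A (t + 3 * pi / 2) - Am)
      = 2 * ((a11 + b22) * (cos t ^ 3 + sin t ^ 3)
      + (a12 + b21) * ((sin t)^2 * cos t + (cos t)^2 * sin t)
      - (a21 + b11 - a22 - b12) * ((sin t)^2 * cos t - (cos t)^2 * sin t)) - 4 * Am"
      using pos unfolding A_def f_eq g_eq sh
      by (simp add: algebra_simps power2_eq_square power3_eq_cube)
    then show ?thesis unfolding E'_def s2 by (simp add: algebra_simps)
  qed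
  have HE: "((\<lambda>t. H t - E t) has_real_derivative
     ((A t - Am) + (A (t + pi / 2) - Am) + (A (t + pi) - Am) + (A (t + 3 * pi / 2) - Am)) - E' t) (at t)" for t
    by (intro derivative_intros H E)
  have "H (pi / 2) - E (pi / 2) = H 0 - E 0"
  proof (rule DERIV_isconst_end[of 0 "pi / 2"])
    show "continuous_on {0..pi / 2} (\<lambda>t. H t - E t)"
      by (rule DERIV_continuous_on, rule DERIV_subset[OF HE subset_UNIV])
    show "((\<lambda>t. H t - E t) has_real_derivative 0) (at t)" if "0 < t" "t < pi / 2" for t
      using HE[of t] eq[OF that] by simp
  qed simp
  moreover have "3 * (Am * pi) = 2 * \<sigma>"
    by (simp add: Am_def)
  then have "3 * (Am * pi) = 2 * (2 * a11 + a12 + b21 + 2 * b22)"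
    by (rule trans[OF _ arg_cong[OF sigma_eq]])
  then have "E (pi / 2) = E 0"
    by (simp add: E_def field_simps)
  moreover have "H (pi / 2) - H 0 = G (2 * pi) - G 0"
    by (simp add: H_def field_simps)
  ultimately have G2: "G (2 * pi) = G 0" by simp
  have "((\<lambda>s. G (s + 2 * pi) - G s) has_real_derivative (A (s + 2 * pi) - Am) - (A s - Am)) (at s)" for s
    by (intro derivative_intros Gs G)
  then have "((\<lambda>s. G (s + 2 * pi) - G s) has_real_derivative 0) (at s)" for s
    by (simp add: A_periodic)
  then have "G (s + 2 * pi) - G s = G (0 + 2 * pi) - G 0" for s
    by (rule DERIV_zero_imp_eq)
  then have Gper: "G (s + 2 * pi) = G s" for s using G2 by simp
  define a where "a s = G s / \<omega>" for s
  have per: "a (s + 2 * pi) = a s" for s by (simp add: a_def Gper)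
  have der: "(a has_real_derivative (A s - Am) / \<omega>) (at s)" for s
    unfolding a_def by (intro DERIV_cdivide G)
  have "continuous_on UNIV (\<lambda>s. \<bar>a s\<bar>)"
    by (intro continuous_intros DERIV_continuous_on[of UNIV a "\<lambda>s. (A s - Am) / \<omega>"]) (use der in simp)
  then obtain k where "\<And>s. \<bar>a s\<bar> \<le> \<bar>a k\<bar>"
    using periodic_2pi_attains_max[of "\<lambda>s. \<bar>a s\<bar>"] per by metis
  with per der show thesis using that by blast
qed

lemma F_lipschitz: "\<exists>L. L-lipschitz_on (cball 0 R) (F \<mu>)"
proof -
  have "lipschitz_bounded (cball 0 R) (\<lambda>p. \<mu> * fst p - \<omega> * snd p + f (fst p) (snd p))"
       "lipschitz_bounded (cball 0 R) (\<lambda>p. \<omega> * fst p + \<mu> * snd p + g (fst p) (snd p))"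
    unfolding f_eq g_eq
    by (intro lipschitz_bounded_add lipschitz_bounded_diff lipschitz_bounded_mult
        lipschitz_bounded_abs lipschitz_bounded_const lipschitz_bounded_fst lipschitz_bounded_snd)+
  then show ?thesis
    unfolding planar_system_def case_prod_beta lipschitz_bounded_def
    using lipschitz_on_Pair by blast
qed

lemma F_zero: "F \<mu> 0 = 0"
  by (simp add: planar_system_def f_eq g_eq zero_prod_def)

text \<open>The left sides are r r' and \<open>r\<^sup>2\<close> times the angular speed;
  \<open>f\<close> and \<open>g\<close> are positively homogeneous of degree two.\<close>

lemma F_polar:
  assumes "p \<noteq> 0"
  shows "fst p * fst (F \<mu> p) + snd p * snd (F \<mu> p) = (norm p)\<^sup>2 * (\<mu> + norm p * A (angle p))"
    and "fst p * snd (F \<mu> p) - snd p * fst (F \<mu> p) = (norm p)\<^sup>2 * (\<omega> + norm p * B (angle p))"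
proof -
  define r s where "r = norm p" and "s = angle p"
  have r: "r > 0" using assms by (simp add: r_def)
  have p: "p = (r * cos s, r * sin s)" unfolding r_def s_def by (rule polar_angle)
  have fg: "f (r * cos s) (r * sin s) = r\<^sup>2 * f (cos s) (sin s)"
       "g (r * cos s) (r * sin s) = r\<^sup>2 * g (cos s) (sin s)"
    using r unfolding f_eq g_eq by (simp_all add: abs_mult algebra_simps power2_eq_square)
  have cs: "(cos s)\<^sup>2 = 1 - (sin s)\<^sup>2" by (rule cos_squared_eq)
  show "fst p * fst (F \<mu> p) + snd p * snd (F \<mu> p) = (norm p)\<^sup>2 * (\<mu> + norm p * A (angle p))"
    "fst p * snd (F \<mu> p) - snd p * fst (F \<mu> p) = (norm p)\<^sup>2 * (\<omega> + norm p * B (angle p))"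
    unfolding r_def[symmetric] s_def[symmetric]
    unfolding p planar_system_def case_prod_conv fst_conv snd_conv fg A_def B_def
    using cs by algebra+
qed

subsection \<open>Periodic orbits as curves over the polar angle\<close>

text \<open>A periodic orbit around the origin is a curve \<open>r = 1 / P(\<phi>)\<close>. The remaining inequalities
  are what smallness of \<open>\<mu>\<close> provides; in particular \<open>P\<close> is close to \<open>- Am / \<mu>\<close>.\<close>

definition slope where "slope \<mu> s v = - (\<mu> * v + A s) * v / (\<omega> * v + B s)"

definition profile :: "real \<Rightarrow> real \<Rightarrow> (real \<Rightarrow> real) \<Rightarrow> bool" where
  "profile R \<mu> P \<longleftrightarrow> \<mu> \<noteq> 0 \<and> \<bar>\<mu>\<bar> \<le> 1 \<and> 4 * \<bar>\<mu>\<bar> * R \<le> \<bar>Am\<bar> \<and> 4 * \<bar>\<mu>\<bar> * M \<le> \<bar>\<omega>\<bar> * \<bar>Am\<bar> \<and>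
     32 * M\<^sup>2 * (1 + \<bar>\<omega>\<bar>) * \<bar>\<mu>\<bar> \<le> (\<bar>\<omega>\<bar> * \<bar>Am\<bar>)\<^sup>2 \<and>
     (\<forall>s. P (s + 2 * pi) = P s) \<and>
     (\<forall>s. 0 < P s \<and> \<bar>Am\<bar> \<le> 2 * \<bar>\<mu>\<bar> * P s \<and> 1 / P s < \<delta> \<and> \<bar>P s + Am / \<mu>\<bar> \<le> R \<and>
        (P has_real_derivative slope \<mu> s (P s)) (at s))"

text \<open>With \<open>\<omega> a' = A - Am\<close>, the function \<open>y = P + a + Am / \<mu>\<close> solves
  \<open>y' = h(s, y) - (\<mu> / \<omega>) y\<close> where \<open>h\<close> is of order \<open>\<mu>\<close> with Lipschitz constant of order \<open>\<mu>\<^sup>2\<close>.\<close>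

lemma profile_exists:
  "\<exists>R m. m > 0 \<and> (\<forall>\<mu>. \<bar>\<mu>\<bar> < m \<and> \<mu> * Am < 0 \<longrightarrow> (\<exists>P. profile R \<mu> P))"
proof -
  obtain a K where a: "\<And>s. a (s + 2 * pi) = a s"
    "\<And>s. (a has_real_derivative (A s - Am) / \<omega>) (at s)" "\<And>s. \<bar>a s\<bar> \<le> K"
    using A_average by blast
  have K: "K \<ge> 0" using a(3)[of 0] by linarith
  define w am where "w = \<bar>\<omega>\<bar>" and "am = \<bar>Am\<bar>"
  have w: "w > 0" and am: "am > 0" using omega Am by (auto simp: w_def am_def)
  \<comment> \<open>Self-map radius: \<open>K\<close> pays for the term \<open>\<mu> * a s\<close>
    of \<open>h\<close>, the quotient for \<open>n s v * B s / q s v\<close>; both are divided by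
    the linear rate \<open>\<mu> / \<omega>\<close>.\<close>
  define R0 where "R0 = K + 2 * C * M / (w * am)"
  define R where "R = R0 + K"
  have R: "R0 \<ge> 0" "R \<ge> 0" using K C M w am by (auto simp: R0_def R_def)
  \<comment> \<open>Reciprocals of thresholds for \<open>\<bar>\<mu>\<bar>\<close>:
    \<open>x1\<close> keeps the denominator \<open>q\<close> away from 0, \<open>x2\<close> gives
    the contraction, \<open>x3\<close> puts the orbit inside radius \<open>\<delta>\<close>. The
    summand 1 in \<open>m\<close> yields \<open>\<bar>\<mu>\<bar> \<le> 1\<close>.\<close>
  define x1 x2 x3 where "x1 = 4 * (w * R + M) / (w * am)"
    and "x2 = 32 * M\<^sup>2 * (1 + w) / (w * am)\<^sup>2" and "x3 = 2 / (am * \<delta>)"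
  have x: "x1 \<ge> 0" "x2 \<ge> 0" "x3 > 0"
    using w am R M delta by (auto simp: x1_def x2_def x3_def)
  define m where "m = 1 / (1 + x1 + x2 + x3)"
  have "m > 0" using x by (simp add: m_def)
  moreover have "\<exists>P. profile R \<mu> P" if mu: "\<bar>\<mu>\<bar> < m" "\<mu> * Am < 0" for \<mu>
  proof -
    have mu0: "\<mu> \<noteq> 0" using mu by auto
    have X: "\<bar>\<mu>\<bar> * (1 + x1 + x2 + x3) < 1"
      using mu(1) x by (simp add: m_def pos_less_divide_eq)
    have small: "\<bar>\<mu>\<bar> * y < 1" if "y \<le> 1 + x1 + x2 + x3" for y
      using mult_left_mono[OF that, of "\<bar>\<mu>\<bar>"] X by simp
    have c0: "\<bar>\<mu>\<bar> \<le> 1" using small[of 1] x by simp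
    have c1: "4 * \<bar>\<mu>\<bar> * (w * R + M) \<le> w * am"
      using small[of x1] x w am by (simp add: x1_def field_simps)
    have c2: "32 * M\<^sup>2 * (1 + w) * \<bar>\<mu>\<bar> \<le> (w * am)\<^sup>2"
      using small[of x2] x w am by (simp add: x2_def field_simps)
    have c3: "2 * \<bar>\<mu>\<bar> < am * \<delta>"
      using small[of x3] x am delta by (simp add: x3_def field_simps)
    have "0 \<le> 4 * \<bar>\<mu>\<bar> * M" "0 \<le> 4 * \<bar>\<mu>\<bar> * (w * R)" using M R w by auto
    then have c1': "4 * \<bar>\<mu>\<bar> * M \<le> w * am" "w * (4 * \<bar>\<mu>\<bar> * R) \<le> w * am"
      using c1 by (simp_all add: algebra_simps)
    then have c1'': "4 * \<bar>\<mu>\<bar> * R \<le> am" using w by simp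
    \<comment> \<open>The reciprocal radius predicted by averaging, of order
      \<open>1 / \<mu>\<close>; it is positive by the sign condition on
      \<open>\<mu>\<close>.\<close>
    define N where "N = - Am / \<mu>"
    have N: "\<mu> * N = - Am" "\<bar>\<mu>\<bar> * N = am" "N > 0"
      using mu mu0 by (auto simp: N_def am_def abs_if mult_less_0_iff divide_less_0_iff)
    \<comment> \<open>With \<open>P = v + N - a\<close>, \<open>q\<close> is
      \<open>\<omega> * P + B\<close> and \<open>n\<close> is \<open>\<mu> * P + A\<close>. Since
      \<open>\<mu> * N = - Am\<close>, \<open>n\<close> remains bounded although \<open>P\<close> is
      large.\<close>
    define q where "q s v = \<omega> * (v + N - a s) + B s" for s v
    define n where "n s v = \<mu> * (v - a s) + A s - Am" for s v
    define h where "h s v = (\<mu> * a s + n s v * B s / q s v) / \<omega>" for s v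
    have va: "\<bar>v - a s\<bar> \<le> R" if "\<bar>v\<bar> \<le> R0" for s v
      using that a(3)[of s] unfolding R_def by linarith
    have q: "w * am \<le> 2 * (\<bar>\<mu>\<bar> * \<bar>q s v\<bar>)" if "\<bar>v\<bar> \<le> R0" for s v
    proof -
      have "N - R \<le> \<bar>v + N - a s\<bar>" using va[OF that, of s] by linarith
      then have "w * (N - R) \<le> \<bar>\<omega> * (v + N - a s)\<bar>"
        using w by (simp add: abs_mult w_def)
      then have "w * (N - R) - M \<le> \<bar>q s v\<bar>"
        using B_bound[of s] unfolding q_def by linarith
      then have "\<bar>\<mu>\<bar> * (w * (N - R) - M) \<le> \<bar>\<mu>\<bar> * \<bar>q s v\<bar>"
        by (intro mult_left_mono) auto
      moreover have "\<bar>\<mu>\<bar> * (w * (N - R) - M) = w * (\<bar>\<mu>\<bar> * N) - \<bar>\<mu>\<bar> * (w * R + M)"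
        by (simp add: algebra_simps)
      ultimately show ?thesis using c1 N(2) mult_pos_pos[OF w am] by simp
    qed
    have q0: "q s v \<noteq> 0" if "\<bar>v\<bar> \<le> R0" for s v
      using q[OF that, of s] mult_pos_pos[OF w am] by auto
    have qinv: "1 / \<bar>q s v\<bar> \<le> 2 * \<bar>\<mu>\<bar> / (w * am)" if "\<bar>v\<bar> \<le> R0" for s v
      using q[OF that, of s] q0[OF that, of s] w am by (simp add: field_simps)
    have n: "\<bar>n s v\<bar> \<le> C" if "\<bar>v\<bar> \<le> R0" for s v
    proof -
      have "\<bar>\<mu> * (v - a s)\<bar> \<le> \<bar>\<mu>\<bar> * R"
        unfolding abs_mult using va[OF that] by (intro mult_left_mono) auto
      then show ?thesis
        using c1'' A_bound[of s] am unfolding n_def C_def am_def by linarith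
    qed
    have "\<exists>y. (\<forall>s. y (s + 2 * pi) = y s) \<and> (\<forall>s. \<bar>y s\<bar> \<le> R0)
      \<and> (\<forall>s. (y has_real_derivative h s (y s) - \<mu> / \<omega> * y s) (at s))"
    proof (rule periodic_2pi_solution_exists)
      show "\<mu> / \<omega> \<noteq> 0" using mu0 omega by simp
      have ca: "continuous_on UNIV a"
        by (rule DERIV_continuous_on[of UNIV a "\<lambda>s. (A s - Am) / \<omega>"]) (simp add: a(2))
      show "continuous_on UNIV (\<lambda>s. h s (y s))" if "continuous_on UNIV y" "\<And>s. \<bar>y s\<bar> \<le> R0" for y
        using q0[OF that(2)] omega unfolding h_def n_def q_def
        by (intro continuous_intros that(1) ca continuous_on_A continuous_on_B) auto
      show "h (s + 2 * pi) v = h s v" for s v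
        by (simp add: h_def n_def q_def a(1) A_periodic B_periodic)
      fix s v assume v: "\<bar>v\<bar> \<le> R0"
      have "\<bar>n s v * B s / q s v\<bar> = \<bar>n s v\<bar> * \<bar>B s\<bar> * (1 / \<bar>q s v\<bar>)"
        by (simp add: abs_mult)
      also have "\<dots> \<le> C * M * (2 * \<bar>\<mu>\<bar> / (w * am))"
        using C M by (intro mult_mono n[OF v] B_bound qinv[OF v]) auto
      finally have "\<bar>n s v * B s / q s v\<bar> \<le> \<bar>\<mu>\<bar> * (2 * C * M / (w * am))" by (simp add: mult_ac)
      moreover have "\<bar>\<mu> * a s\<bar> \<le> \<bar>\<mu>\<bar> * K"
        unfolding abs_mult by (intro mult_left_mono a(3)) auto
      ultimately have "\<bar>\<mu> * a s + n s v * B s / q s v\<bar> \<le> \<bar>\<mu>\<bar> * R0"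
        unfolding R0_def distrib_left by linarith
      then show "\<bar>h s v\<bar> \<le> \<bar>\<mu> / \<omega>\<bar> * R0"
        using w by (simp add: h_def w_def divide_right_mono)
      fix u assume u: "\<bar>u\<bar> \<le> R0"
      have "h s v - h s u = (n s v * B s / q s v - n s u * B s / q s u) / \<omega>"
        by (simp add: h_def diff_divide_distrib[symmetric])
      also have "n s v * B s / q s v - n s u * B s / q s u
          = B s * (n s v * q s u - n s u * q s v) / (q s v * q s u)"
        using q0[OF v] q0[OF u] by (simp add: field_simps)
      \<comment> \<open>The large number \<open>N\<close> enters only through
        \<open>\<mu> * N + Am = 0\<close>, so the numerator is bounded by a multiple of
        \<open>\<bar>v - u\<bar>\<close> and two factors \<open>1 / q\<close> of order
        \<open>\<mu>\<close> remain.\<close>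
      also have "n s v * q s u - n s u * q s v = (\<mu> * B s - \<omega> * A s) * (v - u)"
      proof -
        have "n s v * q s u - n s u * q s v = (\<mu> * B s - \<omega> * A s) * (v - u) + (\<omega> * \<mu> * N + \<omega> * Am) * (v - u)"
          unfolding n_def q_def by (simp add: algebra_simps)
        moreover have "\<omega> * \<mu> * N + \<omega> * Am = 0" using N(1) by (simp add: mult.assoc)
        ultimately show ?thesis by simp
      qed
      finally have "\<bar>h s v - h s u\<bar>
          = \<bar>B s\<bar> * \<bar>\<mu> * B s - \<omega> * A s\<bar> * (1 / \<bar>q s v\<bar>) * (1 / \<bar>q s u\<bar>) * \<bar>v - u\<bar> / w"
        by (simp add: abs_mult w_def)
      also have "\<dots> \<le> M * ((1 + w) * M) * (2 * \<bar>\<mu>\<bar> / (w * am)) * (2 * \<bar>\<mu>\<bar> / (w * am)) * \<bar>v - u\<bar> / w"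
      proof -
        have "\<bar>\<mu> * B s - \<omega> * A s\<bar> \<le> \<bar>\<mu>\<bar> * \<bar>B s\<bar> + w * \<bar>A s\<bar>"
          unfolding w_def abs_mult[symmetric] by (rule abs_triangle_ineq4)
        also have "\<dots> \<le> 1 * M + w * M"
          using M w by (intro add_mono mult_mono c0 B_bound A_bound) auto
        finally have "\<bar>\<mu> * B s - \<omega> * A s\<bar> \<le> (1 + w) * M" by (simp add: algebra_simps)
        then show ?thesis
          using M w am by (intro divide_right_mono mult_right_mono mult_mono B_bound qinv[OF v] qinv[OF u]) auto
      qed
      \<comment> \<open>The constant 32 is set by the later comparison of two profiles; here it
        leaves 1/8 where a factor 1/2 is enough.\<close>
      also have "\<dots> = (32 * M\<^sup>2 * (1 + w) * \<bar>\<mu>\<bar>) * (\<bar>\<mu>\<bar> / w * \<bar>v - u\<bar> / (8 * (w * am)\<^sup>2))"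
        using w am by (simp add: power2_eq_square field_simps)
      also have "\<dots> \<le> (w * am)\<^sup>2 * (\<bar>\<mu>\<bar> / w * \<bar>v - u\<bar> / (8 * (w * am)\<^sup>2))"
        using w am by (intro mult_right_mono c2) auto
      also have "\<dots> = \<bar>\<mu>\<bar> / w * \<bar>v - u\<bar> / 8"
        using w am by simp
      also have "\<dots> \<le> \<bar>\<mu> / \<omega>\<bar> / 2 * \<bar>v - u\<bar>"
      proof -
        have "0 \<le> \<bar>\<mu>\<bar> / w * \<bar>v - u\<bar>" using w by simp
        moreover have "x / 8 \<le> x / 2" if "0 \<le> x" for x :: real using that by simp
        ultimately have "\<bar>\<mu>\<bar> / w * \<bar>v - u\<bar> / 8 \<le> \<bar>\<mu>\<bar> / w * \<bar>v - u\<bar> / 2" by blast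
        then show ?thesis by (simp add: w_def)
      qed
      finally show "\<bar>h s v - h s u\<bar> \<le> \<bar>\<mu> / \<omega>\<bar> / 2 * \<bar>v - u\<bar>" .
    qed (fact R(1))
    then obtain y where y: "\<And>s. y (s + 2 * pi) = y s" "\<And>s. \<bar>y s\<bar> \<le> R0"
      "\<And>s. (y has_real_derivative h s (y s) - \<mu> / \<omega> * y s) (at s)" by blast
    define P where "P s = y s + N - a s" for s
    have PR: "\<bar>P s - N\<bar> \<le> R" for s using va[OF y(2), of s] by (simp add: P_def)
    have mP: "3 * am \<le> 4 * \<bar>\<mu>\<bar> * P s" for s
    proof -
      have "\<bar>\<mu>\<bar> * (N - R) \<le> \<bar>\<mu>\<bar> * P s"
        using PR[of s] by (intro mult_left_mono) linarith+
      then show ?thesis using N(2) c1'' by (simp add: right_diff_distrib)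
    qed
    have P0: "P s > 0" for s
      using mP[of s] am by (smt (verit) mult_nonneg_nonpos zero_le_mult_iff)
    have "profile R \<mu> P"
      unfolding profile_def
    proof (intro conjI allI)
      fix s
      show "\<bar>Am\<bar> \<le> 2 * \<bar>\<mu>\<bar> * P s" using mP[of s] am by (simp add: am_def)
      then have "am * 1 < am * (\<delta> * P s)"
        using mult_strict_right_mono[OF c3 P0[of s]] by (simp add: am_def mult_ac)
      then have "1 < \<delta> * P s" using am mult_less_cancel_left_pos by blast
      then show "1 / P s < \<delta>" using P0[of s] by (simp add: pos_divide_less_eq)
      show "\<bar>P s + Am / \<mu>\<bar> \<le> R" using PR[of s] by (simp add: N_def)
      have qP: "\<omega> * P s + B s = q s (y s)" by (simp add: q_def P_def algebra_simps)
      have nP: "\<mu> * P s + A s = n s (y s)" using N(1) by (simp add: n_def P_def algebra_simps)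
      have "(P has_real_derivative h s (y s) - \<mu> / \<omega> * y s - (A s - Am) / \<omega>) (at s)"
        unfolding P_def by (auto intro!: derivative_eq_intros y(3) a(2))
      moreover have "h s (y s) - \<mu> / \<omega> * y s - (A s - Am) / \<omega> = slope \<mu> s (P s)"
      proof -
        have "\<omega> * (h s (y s) - \<mu> / \<omega> * y s - (A s - Am) / \<omega>) = n s (y s) * B s / q s (y s) - n s (y s)"
        proof -
          have "\<omega> * (h s (y s) - \<mu> / \<omega> * y s - (A s - Am) / \<omega>)
              = \<mu> * a s + n s (y s) * B s / q s (y s) - \<mu> * y s - (A s - Am)"
          proof -
            have "\<omega> * (x / \<omega> - \<mu> / \<omega> * z - c / \<omega>) = x - \<mu> * z - c" for x z c
              using omega by (simp add: field_simps)
            then show ?thesis unfolding h_def .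
          qed
          moreover have "n s (y s) = \<mu> * y s - \<mu> * a s + A s - Am"
            by (simp add: n_def right_diff_distrib)
          ultimately show ?thesis by linarith
        qed
        also have "\<dots> = n s (y s) * (B s - q s (y s)) / q s (y s)"
          using q0[OF y(2)] by (simp add: field_simps)
        also have "B s - q s (y s) = - \<omega> * P s" using qP by simp
        also have "n s (y s) * (- \<omega> * P s) / q s (y s) = \<omega> * slope \<mu> s (P s)"
          by (simp add: slope_def qP nP mult_ac)
        finally show ?thesis using omega by simp
      qed
      ultimately show "(P has_real_derivative slope \<mu> s (P s)) (at s)" by simp
      show "P (s + 2 * pi) = P s" by (simp add: P_def y(1) a(1))
    qed (use mu0 c0 c1' c1'' c2 P0 in \<open>simp_all add: w_def am_def\<close>)
    then show ?thesis by blast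
  qed
  ultimately show ?thesis by blast
qed

text \<open>\<open>P\<close> is so large that \<open>\<omega> * P s\<close> dominates
  \<open>B s\<close>. The slope, which is the rate of 1/r divided by the angular speed, is bounded
  independently of \<open>\<mu>\<close> because the large parts of \<open>\<mu> * P s\<close> and
  \<open>A s\<close> compensate up to \<open>C\<close>.\<close>

lemma profile_bounds:
  assumes "profile R \<mu> P"
  shows "2 * M \<le> \<bar>\<omega>\<bar> * P s" "\<bar>\<omega>\<bar> * P s \<le> 2 * \<bar>\<omega> * P s + B s\<bar>" "\<omega> * P s + B s \<noteq> 0"
    and "\<bar>\<omega>\<bar> * \<bar>slope \<mu> s (P s)\<bar> \<le> 2 * C"
proof -
  have pr: "\<mu> \<noteq> 0" "4 * \<bar>\<mu>\<bar> * R \<le> \<bar>Am\<bar>" "4 * \<bar>\<mu>\<bar> * M \<le> \<bar>\<omega>\<bar> * \<bar>Am\<bar>"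
    "0 < P s" "\<bar>Am\<bar> \<le> 2 * \<bar>\<mu>\<bar> * P s" "\<bar>P s + Am / \<mu>\<bar> \<le> R"
    using assms unfolding profile_def by blast+
  have w: "\<bar>\<omega>\<bar> > 0" using omega by simp
  have "4 * \<bar>\<mu>\<bar> * M \<le> \<bar>\<omega>\<bar> * (2 * \<bar>\<mu>\<bar> * P s)"
    using mult_left_mono[OF pr(5), of "\<bar>\<omega>\<bar>"] by (intro order_trans[OF pr(3)]) simp
  then have "2 * \<bar>\<mu>\<bar> * (2 * M) \<le> 2 * \<bar>\<mu>\<bar> * (\<bar>\<omega>\<bar> * P s)" by (simp add: algebra_simps)
  then show 1: "2 * M \<le> \<bar>\<omega>\<bar> * P s" using pr(1) by simp
  have "\<bar>\<omega> * P s\<bar> = \<bar>\<omega>\<bar> * P s" using pr(4) by (simp add: abs_mult)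
  then show 2: "\<bar>\<omega>\<bar> * P s \<le> 2 * \<bar>\<omega> * P s + B s\<bar>"
  proof -
    define X Y where "X = \<bar>\<omega>\<bar> * P s" and "Y = \<bar>\<omega> * P s + B s\<bar>"
    have "X \<le> Y + \<bar>B s\<bar>"
      using abs_triangle_ineq4[of "\<omega> * P s + B s" "B s"] \<open>\<bar>\<omega> * P s\<bar> = \<bar>\<omega>\<bar> * P s\<close>
      by (simp add: X_def Y_def)
    moreover have "2 * M \<le> X" using 1 by (simp add: X_def)
    ultimately have "X \<le> 2 * Y" using B_bound[of s] by linarith
    then show ?thesis by (simp add: X_def Y_def)
  qed
  then show 3: "\<omega> * P s + B s \<noteq> 0" using mult_pos_pos[OF w pr(4)] by auto
  have "\<bar>\<mu> * P s + A s\<bar> \<le> C"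
  proof -
    have "\<mu> * P s + A s = \<mu> * (P s + Am / \<mu>) + (A s - Am)" using pr(1) by (simp add: algebra_simps)
    moreover have "\<bar>\<mu> * (P s + Am / \<mu>)\<bar> \<le> \<bar>\<mu>\<bar> * R"
      unfolding abs_mult by (intro mult_left_mono pr) simp
    ultimately show ?thesis
      using pr(2) A_bound[of s] unfolding C_def by linarith
  qed
  then have "\<bar>\<mu> * P s + A s\<bar> * (\<bar>\<omega>\<bar> * P s) \<le> C * (2 * \<bar>\<omega> * P s + B s\<bar>)"
    by (rule mult_mono[OF _ 2]) (use pr(4) C in auto)
  then show "\<bar>\<omega>\<bar> * \<bar>slope \<mu> s (P s)\<bar> \<le> 2 * C"
  proof -
    have "\<bar>slope \<mu> s (P s)\<bar> = \<bar>\<mu> * P s + A s\<bar> * P s / \<bar>\<omega> * P s + B s\<bar>"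
      unfolding slope_def using pr(4)
      by (simp only: mult_minus_left minus_divide_left[symmetric] abs_minus_cancel abs_mult
          abs_divide abs_of_pos)
    with 3 show ?thesis
      using \<open>\<bar>\<mu> * P s + A s\<bar> * (\<bar>\<omega>\<bar> * P s) \<le> C * (2 * \<bar>\<omega> * P s + B s\<bar>)\<close>
      by (simp add: pos_divide_le_eq mult_ac)
  qed
qed

section \<open>The deviation from the profile as Lyapunov function\<close>

text \<open>Derivative of 1/r plus a periodic function of the angle. It serves twice: with
  \<open>- P\<close> for uniqueness and stability, and with the antiderivative of
  \<open>A - Am\<close> for nonexistence.\<close>

definition dz :: "(real \<Rightarrow> real) \<Rightarrow> real \<times> real \<Rightarrow> real \<times> real \<Rightarrow> real" where
  "dz Q' p h = - (fst p * fst h + snd p * snd h) / (norm p)^3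
     + Q' (angle p) * ((fst p * snd h - snd p * fst h) / (norm p)\<^sup>2)"

lemma dz_has_derivative:
  assumes "\<And>s. Q (s + 2 * pi) = Q s" "\<And>s. (Q has_real_derivative Q' s) (at s)" "p \<noteq> 0"
  shows "((\<lambda>p. 1 / norm p + Q (angle p)) has_derivative dz Q' p) (at p)"
proof -
  have "(norm has_derivative (\<lambda>h. inner h (sgn p))) (at p)"
    using has_derivative_norm[OF \<open>p \<noteq> 0\<close>] .
  then have "((\<lambda>p. inverse (norm p)) has_derivative
      (\<lambda>h. - (inverse (norm p) * inner h (sgn p) * inverse (norm p)))) (at p)"
    using \<open>p \<noteq> 0\<close> by (intro Deriv.has_derivative_inverse) simp_all
  moreover have "- (inverse (norm p) * inner h (sgn p) * inverse (norm p))
      = - (fst p * fst h + snd p * snd h) / (norm p)^3" for h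
    using \<open>p \<noteq> 0\<close> by (simp add: sgn_div_norm inner_prod_def power3_eq_cube field_simps)
  ultimately have "((\<lambda>p. 1 / norm p) has_derivative
      (\<lambda>h. - (fst p * fst h + snd p * snd h) / (norm p)^3)) (at p)"
    by (simp add: inverse_eq_divide)
  from has_derivative_add[OF this periodic_2pi_angle_has_derivative[of Q, OF assms]]
  show ?thesis unfolding dz_def[abs_def] .
qed

text \<open>In terms of 1/r the quadratic part of the radial equation loses its radius and becomes
  \<open>A\<close>; only the angular correction keeps the factor \<open>norm p\<close>.\<close>

lemma dz_F:
  assumes "p \<noteq> 0"
  shows "dz Q' p (F \<mu> p) = - \<mu> / norm p - A (angle p) + Q' (angle p) * (\<omega> + norm p * B (angle p))"
  using assms unfolding dz_def F_polar[OF assms]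
  by (simp add: power2_eq_square power3_eq_cube field_simps)

definition D :: "(real \<Rightarrow> real) \<Rightarrow> real \<times> real \<Rightarrow> real" where
  "D P p = 1 / norm p - P (angle p)"

definition D' :: "real \<Rightarrow> (real \<Rightarrow> real) \<Rightarrow> real \<times> real \<Rightarrow> real \<times> real \<Rightarrow> real" where
  "D' \<mu> P p h = 2 * D P p * dz (\<lambda>s. - slope \<mu> s (P s)) p h"

lemma D_has_derivative:
  assumes "profile R \<mu> P" "p \<noteq> 0"
  shows "(D P has_derivative dz (\<lambda>s. - slope \<mu> s (P s)) p) (at p)"
proof -
  have "((\<lambda>p. 1 / norm p + - P (angle p)) has_derivative dz (\<lambda>s. - slope \<mu> s (P s)) p) (at p)"
    by (rule dz_has_derivative[where Q = "\<lambda>s. - P s"])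
       (use assms in \<open>auto simp: profile_def intro!: DERIV_minus\<close>)
  then show ?thesis by (simp add: D_def[abs_def])
qed

lemma D2_has_derivative:
  assumes "profile R \<mu> P" "p \<noteq> 0"
  shows "((\<lambda>p. (D P p)\<^sup>2) has_derivative D' \<mu> P p) (at p)"
  unfolding D'_def[abs_def]
  using has_derivative_power[OF D_has_derivative[OF assms], of 2] by (simp add: mult_ac)

text \<open>The profile equation makes the derivative of \<open>D P\<close> vanish where
  \<open>D P\<close> does, and the dependence on r is explicit enough to divide by
  \<open>D P\<close>.\<close>

lemma D_dynamics:
  assumes "profile R \<mu> P" "p \<noteq> 0" "norm p < \<delta>"
  obtains c where "\<bar>c\<bar> \<le> \<bar>\<mu>\<bar> / 2" "D' \<mu> P p (F \<mu> p) = 2 * (c - \<mu>) * (D P p)\<^sup>2"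
proof -
  define r s where "r = norm p" and "s = angle p"
  define S where "S = slope \<mu> s (P s)"
  have r: "0 < r" "r < \<delta>" using assms by (auto simp: r_def)
  have P: "P s > 0" "\<bar>Am\<bar> \<le> 2 * \<bar>\<mu>\<bar> * P s" using assms(1) by (auto simp: profile_def)
  have S: "S * (\<omega> * P s + B s) = - (\<mu> * P s + A s) * P s" "\<bar>\<omega>\<bar> * \<bar>S\<bar> \<le> 2 * C"
    using profile_bounds[OF assms(1), of s] by (auto simp: S_def slope_def)
  \<comment> \<open>From \<open>r - 1 / P s = - (r / P s) * D P p\<close> in the term
    \<open>- S * B s * (r - 1 / P s)\<close>. The bound
    \<open>1 / P s \<le> 2 * \<bar>\<mu>\<bar> / \<bar>Am\<bar>\<close> supplies the factor
    \<open>\<mu>\<close>.\<close>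
  define c where "c = S * B s * r / P s"
  have "dz (\<lambda>s. - slope \<mu> s (P s)) p (F \<mu> p) = - \<mu> / r - A s - S * (\<omega> + r * B s)"
    using dz_F[OF assms(2)] by (simp add: r_def s_def S_def)
  also have "\<dots> = (c - \<mu>) * D P p"
  proof -
    have "S * \<omega> = - (\<mu> * P s + A s) - S * B s / P s"
      using S(1) P(1) by (simp add: field_simps)
    moreover have "(c - \<mu>) * (1 / r - P s) = S * B s / P s - S * B s * r - \<mu> / r + \<mu> * P s"
      using r P(1) by (simp add: c_def field_simps)
    ultimately show ?thesis
      unfolding D_def r_def[symmetric] s_def[symmetric] by (simp add: algebra_simps)
  qed
  finally have eq: "D' \<mu> P p (F \<mu> p) = 2 * (c - \<mu>) * (D P p)\<^sup>2"
    by (simp add: D'_def power2_eq_square mult_ac)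
  have w: "\<bar>\<omega>\<bar> > 0" and am: "\<bar>Am\<bar> > 0" using omega Am by auto
  have "\<bar>\<omega>\<bar> * \<bar>Am\<bar> * \<bar>c\<bar> = (\<bar>\<omega>\<bar> * \<bar>S\<bar>) * \<bar>B s\<bar> * r * (\<bar>Am\<bar> / P s)"
    using r P(1) by (simp add: c_def abs_mult mult_ac)
  also have "\<dots> \<le> 2 * C * M * \<delta> * (2 * \<bar>\<mu>\<bar>)"
    by (intro mult_mono[OF mult_mono[OF mult_mono[OF S(2) B_bound] less_imp_le[OF r(2)]]])
       (use r P C M in \<open>auto simp: pos_divide_le_eq\<close>)
  also have "\<dots> = \<bar>\<omega>\<bar> * \<bar>Am\<bar> * (\<bar>\<mu>\<bar> / 2)"
    using C M by (simp add: \<delta>_def)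
  finally have "\<bar>c\<bar> \<le> \<bar>\<mu>\<bar> / 2"
    using w am by simp
  with eq show thesis using that by blast
qed

definition orbit :: "(real \<Rightarrow> real) \<Rightarrow> (real \<times> real) set" where
  "orbit P = range (\<lambda>s. (cos s / P s, sin s / P s))"

lemma norm_polar: "r > 0 \<Longrightarrow> norm (r * cos s, r * sin s :: real) = r"
  by (simp add: norm_prod_def power_mult_distrib distrib_left[symmetric] real_sqrt_mult)

text \<open>The orbit is the zero set of \<open>D P\<close> off the origin, so statements about it
  can be read off the Lyapunov function.\<close>

lemma orbit_iff:
  assumes "profile R \<mu> P"
  shows "p \<in> orbit P \<longleftrightarrow> p \<noteq> 0 \<and> D P p = 0"
proof
  have P: "\<And>s. P s > 0" "\<And>s. P (s + 2 * pi) = P s" using assms by (auto simp: profile_def)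
  assume "p \<in> orbit P"
  then obtain s where s: "p = ((1 / P s) * cos s, (1 / P s) * sin s)" by (auto simp: orbit_def)
  have "norm p = 1 / P s" unfolding s by (rule norm_polar) (simp add: P)
  moreover have "P (angle p) = P s" unfolding s
    by (rule periodic_2pi_angle_polar) (auto simp: P)
  ultimately show "p \<noteq> 0 \<and> D P p = 0"
    using P(1)[of s] by (auto simp: D_def)
next
  assume p: "p \<noteq> 0 \<and> D P p = 0"
  moreover have "P (angle p) > 0" using assms by (simp add: profile_def)
  ultimately have "norm p = 1 / P (angle p)" by (auto simp: D_def field_simps)
  then have "p = (cos (angle p) / P (angle p), sin (angle p) / P (angle p))"
    using polar_angle[of p] by simp
  then show "p \<in> orbit P" unfolding orbit_def by (rule range_eqI)
qed

lemma norm_orbit: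
  assumes "profile R \<mu> P"
  shows "norm (cos s / P s, sin s / P s) = 1 / P s"
  using norm_polar[of "1 / P s" s] assms by (simp add: profile_def)

lemma orbit_subset_ball:
  assumes "profile R \<mu> P"
  shows "orbit P \<subseteq> ball 0 \<delta> - {0}"
  using orbit_iff[OF assms] norm_orbit[OF assms] assms by (auto simp: orbit_def profile_def)

lemma continuous_on_profile:
  assumes "profile R \<mu> P" shows "continuous_on S P"
  by (rule DERIV_continuous_on[of S P "\<lambda>s. slope \<mu> s (P s)"])
     (use assms in \<open>auto simp: profile_def intro: DERIV_subset\<close>)

lemma compact_orbit:
  assumes "profile R \<mu> P"
  shows "compact (orbit P)"
proof -
  have P: "P s \<noteq> 0" "P (s + 2 * pi) = P s" for s
    using assms unfolding profile_def by (metis less_irrefl)+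
  have "orbit P = (\<lambda>s. (cos s / P s, sin s / P s)) ` {0..2 * pi}"
    unfolding orbit_def by (rule periodic_2pi_range) (simp add: P)
  also have "compact \<dots>"
    by (intro compact_continuous_image continuous_intros continuous_on_profile[OF assms])
       (use P in auto)
  finally show ?thesis .
qed

lemma orbit_asymptotically_stable:
  assumes pr: "profile R \<mu> P" and "\<mu> > 0"
  shows "asymptotically_stable (F \<mu>) (orbit P)"
proof -
  obtain L where L: "L-lipschitz_on (cball 0 \<delta>) (F \<mu>)" using F_lipschitz by blast
  show ?thesis
  proof (rule lyapunov_asymptotically_stable[where U = "ball 0 \<delta> - {0}" and W = "\<lambda>p. (D P p)\<^sup>2"
        and DW = "D' \<mu> P" and k = \<mu> and C = "\<delta>^4" and R = \<delta>, OF compact_orbit[OF pr]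
        orbit_subset_ball[OF pr] _ _ D2_has_derivative[OF pr] _ \<open>\<mu> > 0\<close> _ _ _ _ L])
    fix p :: "real \<times> real" assume p: "p \<in> ball 0 \<delta> - {0}"
    obtain c where c: "\<bar>c\<bar> \<le> \<bar>\<mu>\<bar> / 2" "D' \<mu> P p (F \<mu> p) = 2 * (c - \<mu>) * (D P p)\<^sup>2"
      using D_dynamics[OF pr, of p] p by auto
    have "2 * (c - \<mu>) * (D P p)\<^sup>2 \<le> - \<mu> * (D P p)\<^sup>2"
      using c(1) \<open>\<mu> > 0\<close> by (intro mult_right_mono) auto
    then show "D' \<mu> P p (F \<mu> p) \<le> - \<mu> * (D P p)\<^sup>2" using c by simp
    define r s where "r = norm p" and "s = angle p"
    have P: "P s > 0" "1 / P s < \<delta>" using pr by (auto simp: profile_def)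
    have r: "0 < r" "r < \<delta>" using p by (auto simp: r_def)
    have "infdist p (orbit P) \<le> dist p (cos s / P s, sin s / P s)"
      by (rule infdist_le) (simp add: orbit_def)
    also have "\<dots> = norm ((r - 1 / P s) *\<^sub>R (cos s, sin s))"
    proof -
      have "p = (r * cos s, r * sin s)" unfolding r_def s_def by (rule polar_angle)
      then show ?thesis by (simp add: dist_norm algebra_simps)
    qed
    also have "\<dots> = \<bar>r - 1 / P s\<bar>"
    proof -
      have "norm (cos s, sin s) = 1" using norm_polar[of 1 s] by simp
      then show ?thesis by (simp only: norm_scaleR mult_1_right)
    qed
    \<comment> \<open>Both r and \<open>1 / P s\<close> are below \<open>\<delta>\<close>, so the
      radial gap is at most \<open>\<delta> * \<delta>\<close> times the deviation; squaring gives
      the constant \<open>\<delta>^4\<close>.\<close>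
    also have "r - 1 / P s = - (r * (1 / P s) * D P p)"
      using r P(1) by (simp add: D_def r_def[symmetric] s_def[symmetric] field_simps)
    also have "\<bar>\<dots>\<bar> = r * (1 / P s) * \<bar>D P p\<bar>" using r P(1) by (simp add: abs_mult)
    also have "\<dots> \<le> \<delta> * \<delta> * \<bar>D P p\<bar>"
      using r P by (intro mult_right_mono mult_mono) auto
    finally have "(infdist p (orbit P))\<^sup>2 \<le> (\<delta> * \<delta> * \<bar>D P p\<bar>)\<^sup>2"
      by (intro power_mono infdist_nonneg)
    then show "(infdist p (orbit P))\<^sup>2 \<le> \<delta>^4 * (D P p)\<^sup>2"
      by (simp add: power_mult_distrib power2_eq_square[of "\<delta> * \<delta>"] power4_eq_xxxx mult.assoc)
  qed (use delta orbit_iff[OF pr] in \<open>auto simp: orbit_def\<close>)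
qed

lemma orbit_unstable:
  assumes pr: "profile R \<mu> P" and "\<mu> < 0"
  shows "unstable (F \<mu>) (orbit P)"
proof -
  have P0: "P 0 > 0" and per: "\<And>s. P (s + 2 * pi) = P s" using pr by (auto simp: profile_def)
  show ?thesis
  proof (rule lyapunov_unstable[where U = "ball 0 \<delta> - {0}" and W = "\<lambda>p. (D P p)\<^sup>2"
        and DW = "D' \<mu> P" and k = "- \<mu>" and q = "(1 / P 0, 0)", OF compact_orbit[OF pr]
        orbit_subset_ball[OF pr] _ _ D2_has_derivative[OF pr]])
    fix p :: "real \<times> real" assume p: "p \<in> ball 0 \<delta> - {0}"
    obtain c where c: "\<bar>c\<bar> \<le> \<bar>\<mu>\<bar> / 2" "D' \<mu> P p (F \<mu> p) = 2 * (c - \<mu>) * (D P p)\<^sup>2"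
      using D_dynamics[OF pr, of p] p by auto
    have "- \<mu> * (D P p)\<^sup>2 \<le> 2 * (c - \<mu>) * (D P p)\<^sup>2"
      using c(1) \<open>\<mu> < 0\<close> by (intro mult_right_mono) auto
    then show "- \<mu> * (D P p)\<^sup>2 \<le> D' \<mu> P p (F \<mu> p)" using c by simp
  next
    show "(1 / P 0, 0) \<in> closure {p. (D P p)\<^sup>2 > 0}"
      unfolding closure_approachable
    proof (intro allI impI)
      fix e :: real assume "e > 0"
      \<comment> \<open>Moving outwards along the axis changes the radius but not the angle, so the
        deviation becomes nonzero at once.\<close>
      define r where "r = 1 / P 0 + e / 2"
      have r: "r > 1 / P 0" "r > 0" using \<open>e > 0\<close> P0 by (auto simp: r_def add_pos_pos)
      have "P (angle (r * cos 0, r * sin 0)) = P 0"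
        by (rule periodic_2pi_angle_polar[of P, OF per r(2)])
      then have "D P (r, 0) = 1 / r - P 0" using r by (simp add: D_def)
      also have "\<dots> \<noteq> 0" using r P0 by (auto simp: field_simps)
      finally have "(r, 0) \<in> {p. (D P p)\<^sup>2 > 0}" by simp
      moreover have "dist (r, 0 :: real) (1 / P 0, 0) < e"
        using \<open>e > 0\<close> by (simp add: r_def dist_prod_def dist_real_def)
      ultimately show "\<exists>y\<in>{p. (D P p)\<^sup>2 > 0}. dist y (1 / P 0, 0) < e" by blast
    qed
    show "(1 / P 0, 0) \<in> orbit P"
      unfolding orbit_def by (rule image_eqI[of _ _ 0]) auto
  qed (use \<open>\<mu> < 0\<close> in auto)
qed

section \<open>Stability of the origin\<close>

definition radius2' :: "real \<times> real \<Rightarrow> real \<times> real \<Rightarrow> real" where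
  "radius2' p h = 2 * (fst p * fst h + snd p * snd h)"

lemma radius2_has_derivative:
  "((\<lambda>p. (norm p)\<^sup>2) has_derivative radius2' p) (at p)"
proof -
  have "((\<lambda>p. p \<bullet> p) has_derivative (\<lambda>h. p \<bullet> h + h \<bullet> p)) (at p)"
    by (auto intro!: derivative_eq_intros)
  then show ?thesis
    unfolding radius2'_def[abs_def] power2_norm_eq_inner by (simp add: inner_prod_def algebra_simps)
qed

text \<open>Here the linear term \<open>\<mu>\<close> must dominate \<open>A\<close>, so the
  admissible ball shrinks with \<open>\<mu>\<close>; stability of the origin for a fixed
  \<open>\<mu>\<close> permits this.\<close>

lemma radius2_dynamics:
  assumes "norm p * (2 * M) < \<bar>\<mu>\<bar>"
  obtains c where "\<bar>c\<bar> \<le> \<bar>\<mu>\<bar> / 2" "radius2' p (F \<mu> p) = 2 * (\<mu> + c) * (norm p)\<^sup>2"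
proof (cases "p = 0")
  case True
  then show thesis using that[of 0] by (simp add: radius2'_def F_zero)
next
  case False
  show thesis
  proof
    show "radius2' p (F \<mu> p) = 2 * (\<mu> + norm p * A (angle p)) * (norm p)\<^sup>2"
      by (simp add: radius2'_def F_polar[OF False])
    have "\<bar>norm p * A (angle p)\<bar> \<le> norm p * M"
      unfolding abs_mult using A_bound by (simp add: mult_left_mono)
    then show "\<bar>norm p * A (angle p)\<bar> \<le> \<bar>\<mu>\<bar> / 2" using assms by simp
  qed
qed

lemma origin_asymptotically_stable:
  assumes "\<mu> < 0"
  shows "asymptotically_stable (F \<mu>) {0}"
proof -
  define d where "d = \<bar>\<mu>\<bar> / (2 * M)"
  have d: "d > 0" unfolding d_def using M assms by (intro divide_pos_pos) auto
  obtain L where L: "L-lipschitz_on (cball 0 d) (F \<mu>)" using F_lipschitz by blast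
  show ?thesis
  proof (rule lyapunov_asymptotically_stable[where U = "ball 0 d" and W = "\<lambda>p. (norm p)\<^sup>2"
        and DW = radius2' and k = "- \<mu>" and C = 1, OF _ _ _ _ radius2_has_derivative _ _ _ _ _ _ L])
    fix p :: "real \<times> real" assume p: "p \<in> ball 0 d"
    then have "norm p * (2 * M) < \<bar>\<mu>\<bar>" using M by (simp add: d_def pos_less_divide_eq)
    then obtain c where c: "\<bar>c\<bar> \<le> \<bar>\<mu>\<bar> / 2" "radius2' p (F \<mu> p) = 2 * (\<mu> + c) * (norm p)\<^sup>2"
      by (rule radius2_dynamics)
    have "2 * (\<mu> + c) * (norm p)\<^sup>2 \<le> - (- \<mu>) * (norm p)\<^sup>2"
      using c(1) assms by (intro mult_right_mono) auto
    with c show "radius2' p (F \<mu> p) \<le> - (- \<mu>) * (norm p)\<^sup>2" by simp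
  qed (use assms d in \<open>auto simp: infdist_singleton\<close>)
qed

lemma origin_unstable:
  assumes "\<mu> > 0"
  shows "unstable (F \<mu>) {0}"
proof -
  define d where "d = \<bar>\<mu>\<bar> / (2 * M)"
  have d: "d > 0" unfolding d_def using M assms by (intro divide_pos_pos) auto
  show ?thesis
  proof (rule lyapunov_unstable[where U = "ball 0 d" and W = "\<lambda>p. (norm p)\<^sup>2"
        and DW = radius2' and k = \<mu> and q = 0, OF _ _ _ _ radius2_has_derivative])
    fix p :: "real \<times> real" assume p: "p \<in> ball 0 d"
    then have "norm p * (2 * M) < \<bar>\<mu>\<bar>" using M by (simp add: d_def pos_less_divide_eq)
    then obtain c where c: "\<bar>c\<bar> \<le> \<bar>\<mu>\<bar> / 2" "radius2' p (F \<mu> p) = 2 * (\<mu> + c) * (norm p)\<^sup>2"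
      by (rule radius2_dynamics)
    have "\<mu> * (norm p)\<^sup>2 \<le> 2 * (\<mu> + c) * (norm p)\<^sup>2"
      using c(1) assms by (intro mult_right_mono) auto
    with c show "\<mu> * (norm p)\<^sup>2 \<le> radius2' p (F \<mu> p)" by simp
  next
    show "0 \<in> closure {p :: real \<times> real. (norm p)\<^sup>2 > 0}"
      unfolding closure_approachable
    proof (intro allI impI)
      fix e :: real assume "e > 0"
      then show "\<exists>y\<in>{p :: real \<times> real. (norm p)\<^sup>2 > 0}. dist y 0 < e"
        by (intro bexI[of _ "(e / 2, 0)"]) (auto simp: zero_prod_def dist_prod_def dist_real_def)
    qed
  qed (use assms d in auto)
qed

subsection \<open>Existence and uniqueness of periodic orbits\<close>

lemma periodic_orbit_nonzero:
  assumes "periodic_orbit (F \<mu>) Q" "Q \<subseteq> cball 0 R"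
  shows "0 \<notin> Q"
proof
  assume "0 \<in> Q"
  then obtain y where y: "ode_solution_on (F \<mu>) {0..} y" "y 0 = 0" "Q = y ` {0..}"
    using periodic_orbit_through[OF assms(1)] by metis
  obtain L where L: "L-lipschitz_on (cball 0 R) (F \<mu>)" using F_lipschitz by blast
  have c: "ode_solution_on (F \<mu>) {0..} (\<lambda>_. 0)"
    by (simp add: ode_solution_on_def F_zero)
  have "0 \<in> cball 0 R" using y assms(2) by force
  then have "y t = 0" if "t \<ge> 0" for t
    by (intro ode_solution_on_unique[OF y(1) c _ L _ _ that]) (use y assms(2) in auto)
  then have "Q = {0}" using y(2,3) by force
  then show False using periodic_orbit_nontrivial[OF assms(1)] by blast
qed

text \<open>Over one period the squared deviation returns to its value, yet it is contracted or
  expanded by a factor different from 1; so it is 0.\<close>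

lemma periodic_orbit_subset_orbit:
  assumes pr: "profile R \<mu> P" and Q: "periodic_orbit (F \<mu>) Q" "Q \<subseteq> ball 0 \<delta>"
  shows "Q \<subseteq> orbit P"
proof
  fix q assume q: "q \<in> Q"
  have Q0: "Q \<subseteq> ball 0 \<delta> - {0}"
    using Q periodic_orbit_nonzero[OF Q(1), of \<delta>] by force
  obtain y T where y: "T > 0" "ode_solution_on (F \<mu>) {0..} y" "y T = y 0" "y 0 = q" "Q = y ` {0..}"
    using periodic_orbit_through[OF Q(1) q] .
  have yU: "y t \<in> ball 0 \<delta> - {0}" if "t \<in> {0..T}" for t using y(5) Q0 that by force
  define W where "W = (D P q)\<^sup>2"
  have mu: "\<mu> \<noteq> 0" using pr by (simp add: profile_def)
  have dyn: "\<exists>c. \<bar>c\<bar> \<le> \<bar>\<mu>\<bar> / 2 \<and> D' \<mu> P p (F \<mu> p) = 2 * (c - \<mu>) * (D P p)\<^sup>2"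
    if "p \<in> ball 0 \<delta> - {0}" for p
    using D_dynamics[OF pr, of p] that by auto
  have "W \<le> exp (- \<bar>\<mu>\<bar> * T) * W"
  proof (cases "\<mu> > 0")
    case True
    have "(D P (y T))\<^sup>2 \<le> exp (- \<mu> * T) * (D P (y 0))\<^sup>2"
    proof (rule lyapunov_function_growth[OF y(2) less_imp_le[OF y(1)] yU D2_has_derivative[OF pr]])
      fix p :: "real \<times> real" assume "p \<in> ball 0 \<delta> - {0}"
      then obtain c where c: "\<bar>c\<bar> \<le> \<bar>\<mu>\<bar> / 2" "D' \<mu> P p (F \<mu> p) = 2 * (c - \<mu>) * (D P p)\<^sup>2"
        using dyn by blast
      have "2 * (c - \<mu>) * (D P p)\<^sup>2 \<le> - \<mu> * (D P p)\<^sup>2"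
        using c(1) True by (intro mult_right_mono) auto
      with c show "D' \<mu> P p (F \<mu> p) \<le> - \<mu> * (D P p)\<^sup>2" by simp
    qed auto
    then show ?thesis using True y by (simp add: W_def)
  next
    case False
    have "- (D P (y T))\<^sup>2 \<le> exp (- \<mu> * T) * - (D P (y 0))\<^sup>2"
    proof (rule lyapunov_function_growth[OF y(2) less_imp_le[OF y(1)] yU
          has_derivative_minus[OF D2_has_derivative[OF pr]]])
      fix p :: "real \<times> real" assume "p \<in> ball 0 \<delta> - {0}"
      then obtain c where c: "\<bar>c\<bar> \<le> \<bar>\<mu>\<bar> / 2" "D' \<mu> P p (F \<mu> p) = 2 * (c - \<mu>) * (D P p)\<^sup>2"
        using dyn by blast
      have "- \<mu> * (D P p)\<^sup>2 \<le> 2 * (c - \<mu>) * (D P p)\<^sup>2"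
        using c(1) False by (intro mult_right_mono) auto
      with c show "- D' \<mu> P p (F \<mu> p) \<le> - \<mu> * - (D P p)\<^sup>2" by simp
    qed auto
    then have "exp (- \<mu> * T) * W \<le> W" using y by (simp add: W_def)
    \<comment> \<open>Expansion over a period read backwards is contraction by
      \<open>exp (\<mu> * T)\<close>, so both signs of \<open>\<mu>\<close> end in the same
      inequality.\<close>
    then have "exp (\<mu> * T) * (exp (- \<mu> * T) * W) \<le> exp (\<mu> * T) * W" by simp
    then show ?thesis using False by (simp add: mult.assoc[symmetric] exp_add[symmetric])
  qed
  moreover have "exp (- \<bar>\<mu>\<bar> * T) < 1" using y(1) mu by simp
  moreover have "W \<ge> 0" by (simp add: W_def)
  ultimately have "W = 0"
    by (smt (verit) mult_less_cancel_right2)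
  then show "q \<in> orbit P"
    using orbit_iff[OF pr] q Q0 by (auto simp: W_def)
qed

text \<open>The angle has to be turned into time. \<open>S'\<close> is \<open>\<omega>\<close>
  divided by the angular speed \<open>\<omega> + B s / P s\<close>, so \<open>S\<close> measures
  \<open>\<omega>\<close> times the elapsed time. The factor \<open>\<omega>\<close> makes
  \<open>S\<close> increasing for either sense of rotation, and its inverse gives the angle as a
  function of \<open>\<omega> * t\<close>.\<close>

lemma orbit_periodic:
  assumes pr: "profile R \<mu> P"
  shows "periodic_orbit (F \<mu>) (orbit P)"
proof -
  have P: "P s > 0" "P (s + 2 * pi) = P s" "(P has_real_derivative slope \<mu> s (P s)) (at s)" for s
    using pr by (auto simp: profile_def)
  note q = profile_bounds[OF pr]
  define S' where "S' s = \<omega> * P s / (\<omega> * P s + B s)" for s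
  have S'_ge: "S' s \<ge> 1 / 2" for s
  proof -
    define b where "b = B s / (\<omega> * P s)"
    have nz: "\<omega> * P s \<noteq> 0" using omega P(1)[of s] by simp
    have "\<bar>b\<bar> \<le> M / (\<bar>\<omega>\<bar> * P s)"
      unfolding b_def abs_divide abs_mult using B_bound[of s] P(1)[of s] by (simp add: divide_right_mono)
    also have "\<dots> \<le> 1 / 2"
      using q(1)[of s] omega P(1)[of s] by (simp add: field_simps)
    finally have b: "\<bar>b\<bar> \<le> 1 / 2" .
    have "S' s = 1 / (1 + b)"
      using nz q(3)[of s] by (simp add: S'_def b_def field_simps)
    also have "\<dots> \<ge> 1 / 2" using b by (simp add: field_simps abs_le_iff)
    finally show ?thesis .
  qed
  have "continuous_on UNIV S'"
    unfolding S'_def by (intro continuous_intros continuous_on_profile[OF pr] continuous_on_B) (use q in auto)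
  then obtain S where S: "\<And>s. (S has_real_derivative S' s) (at s)"
    by (rule antiderivative_exists) blast
  have mono: "S s < S t" if "s < t" for s t
    by (rule DERIV_pos_imp_increasing[OF that]) (use S S'_ge in \<open>force intro: less_le_trans[of 0 "1/2"]\<close>)
  obtain \<theta> where \<theta>: "\<And>t. S (\<theta> t) = t" "\<And>s. \<theta> (S s) = s"
    "\<And>t. (\<theta> has_real_derivative inverse (S' (\<theta> t))) (at t)"
    using increasing_inverse_exists[of S S' "1/2", OF S S'_ge] by auto
  define T0 where "T0 = S (2 * pi) - S 0"
  have T0: "T0 > 0" using mono[of 0 "2 * pi"] by (simp add: T0_def)
  have Sper: "S (s + 2 * pi) = S s + T0" for s
  proof -
    have "((\<lambda>s. S (s + 2 * pi) - S s) has_real_derivative S' (s + 2 * pi) - S' s) (at s)" for s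
      using S[of "s + 2 * pi"] by (intro derivative_intros S) (simp add: DERIV_shift)
    then have "((\<lambda>s. S (s + 2 * pi) - S s) has_real_derivative 0) (at s)" for s
      by (simp add: S'_def P(2) B_periodic)
    then have "S (s + 2 * pi) - S s = S (0 + 2 * pi) - S 0"
      by (rule DERIV_zero_imp_eq)
    then show ?thesis by (simp add: T0_def)
  qed
  have \<theta>per: "\<theta> (t + T0) = \<theta> t + 2 * pi" for t
    using Sper[of "\<theta> t"] \<theta> by metis
  define X where "X s = (cos s / P s, sin s / P s)" for s
  have Xper: "X (s + 2 * pi) = X s" for s by (simp add: X_def P(2))
  define x where "x t = X (\<theta> (\<omega> * t))" for t
  define T where "T = T0 / \<bar>\<omega>\<bar>"
  have "T > 0" using T0 omega by (simp add: T_def)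
  moreover have "x (t + T) = x t" for t
  proof (cases "\<omega> > 0")
    case True
    then have "\<omega> * (t + T) = \<omega> * t + T0" by (simp add: T_def field_simps)
    then show ?thesis by (simp add: x_def \<theta>per Xper)
  next
    case False
    then have "\<omega> * t = \<omega> * (t + T) + T0" using omega by (simp add: T_def field_simps)
    then have "\<theta> (\<omega> * t) = \<theta> (\<omega> * (t + T)) + 2 * pi" by (metis \<theta>per)
    then show ?thesis by (simp add: x_def Xper)
  qed
  moreover have range: "range x = range X"
  proof -
    have "X s = x (S s / \<omega>)" for s by (simp add: x_def omega \<theta>(2))
    then have "range X \<subseteq> range x" by (metis image_subsetI rangeI)
    moreover have "range x \<subseteq> range X" by (auto simp: x_def)
    ultimately show ?thesis by blast
  qed
  moreover have "\<exists>s t. x s \<noteq> x t"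
  proof (rule ccontr)
    assume "\<not> ?thesis"
    \<comment> \<open>The angles 0 and \<open>pi\<close> lie on opposite half-axes, so a constant
      solution is impossible.\<close>
    then have "X 0 = X pi" using range by (metis rangeE rangeI)
    then have "1 / P 0 = - 1 / P pi" by (simp add: X_def)
    then show False using P(1)[of 0] P(1)[of pi] by (simp add: field_simps)
  qed
  moreover have "ode_solution_on (F \<mu>) UNIV x"
    unfolding ode_solution_on_def
  proof
    fix t
    define s where "s = \<theta> (\<omega> * t)"
    define v where "v = slope \<mu> s (P s)"
    have v: "v * (\<omega> * P s + B s) = - (\<mu> * P s + A s) * P s"
      using q(3)[of s] by (simp add: v_def slope_def)
    have Xd: "(X has_vector_derivative ((- sin s * P s - cos s * v) / (P s * P s),
        (cos s * P s - sin s * v) / (P s * P s))) (at s)"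
      unfolding X_def v_def using P(1)[of s]
      by (intro has_vector_derivative_Pair;
          unfold has_real_derivative_iff_has_vector_derivative[symmetric])
         (auto intro!: derivative_eq_intros P(3))
    have "((\<lambda>t. \<theta> (\<omega> * t)) has_real_derivative inverse (S' s) * \<omega>) (at t)"
      using \<theta>(3) unfolding s_def by (rule DERIV_chain2) (auto intro!: derivative_eq_intros)
    then have "((\<lambda>t. \<theta> (\<omega> * t)) has_vector_derivative inverse (S' s) * \<omega>) (at t)"
      by (simp only: has_real_derivative_iff_has_vector_derivative)
    from vector_diff_chain_at[OF this, of X, folded s_def, OF Xd]
    have "(x has_vector_derivative (inverse (S' s) * \<omega>) *\<^sub>R ((- sin s * P s - cos s * v) / (P s * P s),
        (cos s * P s - sin s * v) / (P s * P s))) (at t)"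
      by (simp only: x_def[abs_def] o_def)
    moreover have "inverse (S' s) * \<omega> = (\<omega> * P s + B s) / P s"
      using omega P(1)[of s] by (simp add: S'_def field_simps)
    moreover have "((\<omega> * P s + B s) / P s) *\<^sub>R ((- sin s * P s - cos s * v) / (P s * P s),
        (cos s * P s - sin s * v) / (P s * P s)) = F \<mu> (X s)"
    proof -
      have P0: "P s \<noteq> 0" using P(1)[of s] by simp
      have hom: "f (cos s / P s) (sin s / P s) = f (cos s) (sin s) / (P s)\<^sup>2"
           "g (cos s / P s) (sin s / P s) = g (cos s) (sin s) / (P s)\<^sup>2"
        using P(1)[of s] unfolding f_eq g_eq
        by (simp_all add: power2_eq_square add_divide_distrib)
      have fg: "f (cos s) (sin s) = cos s * A s - sin s * B s"
        "g (cos s) (sin s) = sin s * A s + cos s * B s"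
        unfolding A_def B_def using cos_squared_eq[of s] by algebra+
      have "((\<omega> * P s + B s) / P s) * ((- sin s * P s - cos s * v) / (P s * P s))
         = (- sin s * P s * (\<omega> * P s + B s) - cos s * (v * (\<omega> * P s + B s))) / (P s)^3"
        by (simp add: power3_eq_cube algebra_simps)
      also have "\<dots> = \<mu> * (cos s / P s) - \<omega> * (sin s / P s) + f (cos s / P s) (sin s / P s)"
        unfolding v hom fg using P0 by (simp add: power3_eq_cube power2_eq_square field_simps)
      finally have 1: "((\<omega> * P s + B s) / P s) * ((- sin s * P s - cos s * v) / (P s * P s))
         = \<mu> * (cos s / P s) - \<omega> * (sin s / P s) + f (cos s / P s) (sin s / P s)" .
      have "((\<omega> * P s + B s) / P s) * ((cos s * P s - sin s * v) / (P s * P s))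
         = (cos s * P s * (\<omega> * P s + B s) - sin s * (v * (\<omega> * P s + B s))) / (P s)^3"
        by (simp add: power3_eq_cube algebra_simps)
      also have "\<dots> = \<omega> * (cos s / P s) + \<mu> * (sin s / P s) + g (cos s / P s) (sin s / P s)"
        unfolding v hom fg using P0 by (simp add: power3_eq_cube power2_eq_square field_simps)
      finally have 2: "((\<omega> * P s + B s) / P s) * ((cos s * P s - sin s * v) / (P s * P s))
         = \<omega> * (cos s / P s) + \<mu> * (sin s / P s) + g (cos s / P s) (sin s / P s)" .
      show ?thesis
        unfolding scaleR_Pair real_scaleR_def 1 2 by (simp add: X_def planar_system_def)
    qed
    ultimately show "(x has_vector_derivative F \<mu> (x t)) (at t)"
      by (simp add: x_def s_def)
  qed
  ultimately show ?thesis
    unfolding periodic_orbit_def orbit_def X_def[symmetric] by blast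
qed

lemma periodic_orbit_iff:
  assumes pr: "profile R \<mu> P"
  shows "periodic_orbit (F \<mu>) Q \<and> Q \<subseteq> ball 0 \<delta> \<longleftrightarrow> Q = orbit P"
proof
  assume Q: "periodic_orbit (F \<mu>) Q \<and> Q \<subseteq> ball 0 \<delta>"
  obtain q where q: "q \<in> Q" using Q unfolding periodic_orbit_def by blast
  have "Q \<subseteq> orbit P" by (rule periodic_orbit_subset_orbit[OF pr]) (use Q in auto)
  moreover obtain L where L: "L-lipschitz_on (cball 0 \<delta>) (F \<mu>)" using F_lipschitz by blast
  ultimately show "Q = orbit P"
    using periodic_orbit_eqI[OF _ orbit_periodic[OF pr] q _ L] q Q orbit_subset_ball[OF pr]
    by (meson Diff_subset ball_subset_cball order_trans subsetD)
next
  assume "Q = orbit P"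
  then show "periodic_orbit (F \<mu>) Q \<and> Q \<subseteq> ball 0 \<delta>"
    using orbit_periodic[OF pr] orbit_subset_ball[OF pr] by blast
qed

text \<open>Here \<open>1 / r + a(\<phi>)\<close> with \<open>\<omega> a' = A - Am\<close> is strictly monotone along solutions, since up to
  small terms its derivative is \<open>- \<mu> / r - Am\<close>.\<close>

lemma no_periodic_orbit:
  assumes "\<mu> * Am \<ge> 0" "periodic_orbit (F \<mu>) Q" "Q \<subseteq> ball 0 \<delta>"
  shows False
proof -
  obtain a K where a: "\<And>s. a (s + 2 * pi) = a s"
    "\<And>s. (a has_real_derivative (A s - Am) / \<omega>) (at s)" "\<And>s. \<bar>a s\<bar> \<le> K"
    using A_average by blast
  have Q0: "Q \<subseteq> ball 0 \<delta> - {0}"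
    using assms periodic_orbit_nonzero[OF assms(2), of \<delta>] by force
  obtain q where "q \<in> Q" using assms(2) unfolding periodic_orbit_def by blast
  then obtain y T where y: "T > 0" "ode_solution_on (F \<mu>) {0..} y" "y T = y 0" "Q = y ` {0..}"
    using periodic_orbit_through[OF assms(2)] by metis
  have yU: "y t \<in> ball 0 \<delta> - {0}" if "t \<in> {0..T}" for t using y(4) Q0 that by force
  define z where "z p = 1 / norm p + a (angle p)" for p :: "real \<times> real"
  define z' where "z' = dz (\<lambda>s. (A s - Am) / \<omega>)"
  have z: "(z has_derivative z' p) (at p)" if "p \<noteq> 0" for p
    unfolding z_def z'_def by (rule dz_has_derivative[OF a(1,2) that])
  \<comment> \<open>The factor \<open>Am\<close> fixes the direction of monotonicity: it turns
    \<open>- Am\<close> into \<open>- Am\<^sup>2\<close> and \<open>- \<mu> / r\<close> into a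
    nonpositive term. The exponential converts the constant rate into the multiplicative form of the
    growth lemma.\<close>
  have "exp (Am * z (y T)) \<le> exp (- (Am\<^sup>2 / 2) * T) * exp (Am * z (y 0))"
  proof (rule lyapunov_function_growth[OF y(2) less_imp_le[OF y(1)] yU,
        where DW = "\<lambda>p h. exp (Am * z p) * (Am * z' p h)"])
    fix p :: "real \<times> real" assume p: "p \<in> ball 0 \<delta> - {0}"
    have "((\<lambda>p. Am * z p) has_derivative (\<lambda>h. Am * z' p h)) (at p)"
      using z p by (intro has_derivative_mult_right) auto
    then show "((\<lambda>p. exp (Am * z p)) has_derivative (\<lambda>h. exp (Am * z p) * (Am * z' p h))) (at p)"
      by (rule has_derivative_exp[THEN has_derivative_eq_rhs]) (auto simp: mult.commute)
    define r s where "r = norm p" and "s = angle p"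
    have r: "0 < r" "r < \<delta>" using p by (auto simp: r_def)
    have w: "\<bar>\<omega>\<bar> > 0" using omega by simp
    define e where "e = (A s - Am) * (r * B s) / \<omega>"
    have "z' p (F \<mu> p) = - \<mu> / r - A s + (A s - Am) / \<omega> * (\<omega> + r * B s)"
      unfolding z'_def using dz_F[of p] p by (simp add: r_def s_def)
    also have "\<dots> = - \<mu> / r - Am + e"
    proof -
      have "c / \<omega> * (\<omega> + b) = c + c * b / \<omega>" for b c
        using omega by (simp add: field_simps)
      then show ?thesis by (simp add: e_def)
    qed
    finally have zF: "z' p (F \<mu> p) = - \<mu> / r - Am + e" .
    have eq: "Am * z' p (F \<mu> p) = - (\<mu> * Am) / r - Am\<^sup>2 + Am * e"
      unfolding zF by (simp add: algebra_simps power2_eq_square)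
    have "\<bar>\<omega>\<bar> * \<bar>e\<bar> = \<bar>A s - Am\<bar> * r * \<bar>B s\<bar>"
      using omega r by (simp add: e_def abs_mult)
    also have "\<dots> \<le> C * \<delta> * M"
    proof -
      have "\<bar>A s - Am\<bar> \<le> C" using A_bound[of s] C(2) by linarith
      then show ?thesis
        by (intro mult_mono[OF mult_mono B_bound]) (use r C delta in auto)
    qed
    also have "\<dots> = \<bar>\<omega>\<bar> * (\<bar>Am\<bar> / 8)" using C M by (simp add: \<delta>_def)
    finally have "\<bar>e\<bar> \<le> \<bar>Am\<bar> / 8" using w by simp
    then have "\<bar>Am * e\<bar> \<le> \<bar>Am\<bar> * (\<bar>Am\<bar> / 8)"
      unfolding abs_mult by (intro mult_left_mono) auto
    also have "\<dots> = Am\<^sup>2 / 8" by (simp add: power2_eq_square)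
    finally have "Am * e \<le> Am\<^sup>2 / 8" by linarith
    moreover have "0 \<le> (\<mu> * Am) / r" using assms(1) r by simp
    moreover have "0 \<le> Am\<^sup>2" by simp
    ultimately have "Am * z' p (F \<mu> p) \<le> - (Am\<^sup>2 / 2)"
      unfolding eq by linarith
    then have "exp (Am * z p) * (Am * z' p (F \<mu> p)) \<le> exp (Am * z p) * - (Am\<^sup>2 / 2)"
      by (intro mult_left_mono) auto
    then show "exp (Am * z p) * (Am * z' p (F \<mu> p)) \<le> - (Am\<^sup>2 / 2) * exp (Am * z p)"
      by (simp add: mult.commute)
  qed
  then have "1 \<le> exp (- (Am\<^sup>2 / 2) * T)" using y(3) by simp
  moreover have "Am\<^sup>2 / 2 * T > 0" using Am y(1) by simp
  ultimately show False by simp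
qed

section \<open>Dependence of the profile on the parameter\<close>

text \<open>A bounded error in the reciprocal radius is a quadratic error in the radius, since
  taking reciprocals multiplies it by \<open>1 / P s\<close> and \<open>\<mu> / Am\<close>, both of
  order \<open>\<mu>\<close>.\<close>

lemma profile_asymptotics:
  assumes "profile R \<mu> P"
  shows "\<bar>1 / P s - (- (\<mu> / Am))\<bar> \<le> 2 * R / Am\<^sup>2 * \<mu>\<^sup>2"
proof -
  have pr: "\<mu> \<noteq> 0" "0 < P s" "\<bar>Am\<bar> \<le> 2 * \<bar>\<mu>\<bar> * P s" "\<bar>P s + Am / \<mu>\<bar> \<le> R"
    using assms unfolding profile_def by blast+
  have R: "R \<ge> 0" using pr(4) by linarith
  have "1 / P s - (- (\<mu> / Am)) = \<mu> * (P s + Am / \<mu>) / Am * (1 / P s)"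
    using pr(1,2) Am by (simp add: field_simps)
  then have "\<bar>1 / P s - (- (\<mu> / Am))\<bar> = \<bar>\<mu>\<bar> * \<bar>P s + Am / \<mu>\<bar> / \<bar>Am\<bar> * (1 / P s)"
    using pr(2) by (simp add: abs_mult)
  also have "\<dots> \<le> \<bar>\<mu>\<bar> * R / \<bar>Am\<bar> * (2 * \<bar>\<mu>\<bar> / \<bar>Am\<bar>)"
    using pr R Am by (intro mult_mono divide_right_mono mult_left_mono) (auto simp: field_simps)
  also have "\<dots> = 2 * R / Am\<^sup>2 * \<mu>\<^sup>2"
    by (simp add: power2_eq_square)
  finally show ?thesis .
qed

text \<open>Where the difference of two profiles is extremal, their slopes agree.\<close>

lemma profile_dist:
  assumes prP: "profile R \<mu> P" and prQ: "profile R \<nu> Q"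
  shows "\<bar>P s - Q s\<bar> \<le> 4 * \<bar>\<mu> - \<nu>\<bar> / \<bar>\<mu>\<bar> * (\<bar>Am\<bar> / \<bar>\<nu>\<bar> + R)"
proof -
  have P: "P s > 0" "P (s + 2 * pi) = P s" "(P has_real_derivative slope \<mu> s (P s)) (at s)"
    "\<bar>Am\<bar> \<le> 2 * \<bar>\<mu>\<bar> * P s" for s
    using prP by (auto simp: profile_def)
  have Q: "Q s > 0" "Q (s + 2 * pi) = Q s" "(Q has_real_derivative slope \<nu> s (Q s)) (at s)"
    "\<bar>Am\<bar> \<le> 2 * \<bar>\<nu>\<bar> * Q s" "\<bar>Q s + Am / \<nu>\<bar> \<le> R" for s
    using prQ by (auto simp: profile_def)
  have mn: "\<mu> \<noteq> 0" "\<bar>\<mu>\<bar> \<le> 1" "\<nu> \<noteq> 0"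
    "32 * M\<^sup>2 * (1 + \<bar>\<omega>\<bar>) * \<bar>\<nu>\<bar> \<le> (\<bar>\<omega>\<bar> * \<bar>Am\<bar>)\<^sup>2"
    using prP prQ by (auto simp: profile_def)
  define w where "w = \<bar>\<omega>\<bar>"
  define am where "am = \<bar>Am\<bar>"
  have w: "w > 0" and am: "am > 0" using omega Am by (auto simp: w_def am_def)
  have R: "R \<ge> 0" using Q(5)[of 0] by linarith
  show ?thesis
  proof (rule periodic_2pi_critical_point_bound[where y = "\<lambda>s. P s - Q s"
        and y' = "\<lambda>s. slope \<mu> s (P s) - slope \<nu> s (Q s)"])
    fix s
    assume crit: "slope \<mu> s (P s) - slope \<nu> s (Q s) = 0"
    define x v where "x = P s" and "v = Q s"
    define qx qv where "qx = \<omega> * x + B s" and "qv = \<omega> * v + B s"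
    have qx: "w * x \<le> 2 * \<bar>qx\<bar>" "qx \<noteq> 0" and qv: "w * v \<le> 2 * \<bar>qv\<bar>" "qv \<noteq> 0"
      using profile_bounds(2,3)[OF prP, of s] profile_bounds(2,3)[OF prQ, of s]
      by (simp_all add: x_def v_def qx_def qv_def w_def)
    have xv: "x > 0" "v > 0" "am \<le> 2 * \<bar>\<mu>\<bar> * x" "am \<le> 2 * \<bar>\<nu>\<bar> * v"
      using P[of s] Q[of s] by (auto simp: x_def v_def am_def)
    \<comment> \<open>\<open>\<mu> - E\<close> is \<open>- \<omega>\<close> times the difference
      quotient of \<open>slope \<mu> s\<close> between \<open>x\<close> and \<open>v\<close>. As
      \<open>E\<close> carries two reciprocals of large quantities, it is at most
      \<open>\<bar>\<mu>\<bar> / 2\<close>, and the quotient stays away from 0.\<close>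
    define E where "E = B s * (\<mu> * B s - \<omega> * A s) / (qx * qv)"
    have "- (\<mu> * x + A s) * x / qx = - (\<nu> * v + A s) * v / qv"
      using crit unfolding slope_def x_def[symmetric] v_def[symmetric] qx_def[symmetric] qv_def[symmetric]
      by simp
    then have "- (\<mu> * x + A s) * x * qv = - (\<nu> * v + A s) * v * qx"
      by (simp only: frac_eq_eq[OF qx(2) qv(2)])
    \<comment> \<open>Cross-multiplied, equal slopes leave only the difference of parameters on the
      right, while everything else is divisible by \<open>x - v\<close>.\<close>
    then have key: "(x - v) * (\<mu> * qx * qv - B s * (\<mu> * B s - \<omega> * A s)) = \<omega> * (\<nu> - \<mu>) * v\<^sup>2 * qx"
    proof -
      have "(x - v) * (\<mu> * qx * qv - B s * (\<mu> * B s - \<omega> * A s))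
          = \<omega> * ((\<mu> * x + A s) * x * qv - (\<mu> * v + A s) * v * qx)"
        unfolding qx_def qv_def by (simp add: algebra_simps)
      also have "(\<mu> * x + A s) * x * qv = (\<nu> * v + A s) * v * qx"
        using \<open>- (\<mu> * x + A s) * x * qv = - (\<nu> * v + A s) * v * qx\<close>
        by (simp only: mult_minus_left neg_equal_iff_equal)
      finally show ?thesis by (simp add: algebra_simps power2_eq_square)
    qed
    have "(x - v) * (\<mu> - E) = \<omega> * (\<nu> - \<mu>) * v\<^sup>2 / qv"
    proof -
      have "(x - v) * (\<mu> - E) = (x - v) * (\<mu> * qx * qv - B s * (\<mu> * B s - \<omega> * A s)) / (qx * qv)"
        using qx qv by (simp add: E_def field_simps)
      then show ?thesis unfolding key using qx by simp
    qed
    then have "\<bar>x - v\<bar> * \<bar>\<mu> - E\<bar> = \<bar>\<mu> - \<nu>\<bar> * v * (w * v / \<bar>qv\<bar>)"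
      using xv by (simp add: abs_mult[symmetric] w_def) (simp add: abs_mult power2_eq_square abs_minus_commute)
    also have "\<dots> \<le> \<bar>\<mu> - \<nu>\<bar> * v * 2"
      using xv qv by (intro mult_left_mono) (auto simp: pos_divide_le_eq)
    finally have 1: "\<bar>x - v\<bar> * \<bar>\<mu> - E\<bar> \<le> 2 * \<bar>\<mu> - \<nu>\<bar> * v" by simp
    have "\<bar>E\<bar> = \<bar>B s\<bar> * \<bar>\<mu> * B s - \<omega> * A s\<bar> * (1 / \<bar>qx\<bar>) * (1 / \<bar>qv\<bar>)"
      by (simp add: E_def abs_mult)
    also have "\<dots> \<le> M * ((1 + w) * M) * (4 * \<bar>\<mu>\<bar> / (w * am)) * (4 * \<bar>\<nu>\<bar> / (w * am))"
    proof -
      have "\<bar>\<mu> * B s - \<omega> * A s\<bar> \<le> \<bar>\<mu>\<bar> * \<bar>B s\<bar> + w * \<bar>A s\<bar>"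
        unfolding w_def abs_mult[symmetric] by (rule abs_triangle_ineq4)
      also have "\<dots> \<le> 1 * M + w * M"
        using M w by (intro add_mono mult_mono mn B_bound A_bound) auto
      finally have a: "\<bar>\<mu> * B s - \<omega> * A s\<bar> \<le> (1 + w) * M" by (simp add: algebra_simps)
      have inv: "1 / \<bar>q\<bar> \<le> 4 * k / (w * am)"
        if "w * u \<le> 2 * \<bar>q\<bar>" "q \<noteq> 0" "am \<le> 2 * k * u" "k \<ge> 0" for q u k
      proof -
        have "w * am \<le> w * (2 * k * u)" using that w by (intro mult_left_mono) auto
        also have "\<dots> = 2 * k * (w * u)" by simp
        also have "\<dots> \<le> 2 * k * (2 * \<bar>q\<bar>)" using that by (intro mult_left_mono) auto
        finally show ?thesis using that w am by (simp add: field_simps)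
      qed
      show ?thesis
        using M w am by (intro mult_mono B_bound a inv[OF qx xv(3)] inv[OF qv xv(4)]) auto
    qed
    also have "\<dots> = (32 * M\<^sup>2 * (1 + w) * \<bar>\<nu>\<bar>) * (\<bar>\<mu>\<bar> / (2 * (w * am)\<^sup>2))"
      using w am by (simp add: power2_eq_square field_simps)
    also have "\<dots> \<le> (w * am)\<^sup>2 * (\<bar>\<mu>\<bar> / (2 * (w * am)\<^sup>2))"
      using mn(4) unfolding w_def am_def by (intro mult_right_mono) auto
    also have "\<dots> = \<bar>\<mu>\<bar> / 2" using w am by simp
    finally have "\<bar>\<mu>\<bar> / 2 \<le> \<bar>\<mu> - E\<bar>" by linarith
    then have "\<bar>x - v\<bar> * (\<bar>\<mu>\<bar> / 2) \<le> \<bar>x - v\<bar> * \<bar>\<mu> - E\<bar>" by (intro mult_left_mono) auto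
    with 1 have "\<bar>x - v\<bar> * \<bar>\<mu>\<bar> \<le> 4 * \<bar>\<mu> - \<nu>\<bar> * v" by simp
    then have "\<bar>x - v\<bar> \<le> 4 * \<bar>\<mu> - \<nu>\<bar> / \<bar>\<mu>\<bar> * v" using mn(1) by (simp add: field_simps)
    also have "\<dots> \<le> 4 * \<bar>\<mu> - \<nu>\<bar> / \<bar>\<mu>\<bar> * (\<bar>Am\<bar> / \<bar>\<nu>\<bar> + R)"
    proof (rule mult_left_mono)
      have "\<bar>Am / \<nu>\<bar> = \<bar>Am\<bar> / \<bar>\<nu>\<bar>" by simp
      then show "v \<le> \<bar>Am\<bar> / \<bar>\<nu>\<bar> + R" using Q(5)[of s] unfolding v_def by linarith
    qed simp
    finally show "\<bar>P s - Q s\<bar> \<le> 4 * \<bar>\<mu> - \<nu>\<bar> / \<bar>\<mu>\<bar> * (\<bar>Am\<bar> / \<bar>\<nu>\<bar> + R)"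
      by (simp add: x_def v_def)
  qed (use P(2) Q(2) R in \<open>auto intro!: DERIV_diff P(3) Q(3)\<close>)
qed

section \<open>The bifurcation\<close>

lemma Hopf_bifurcation:
  "\<exists>I U J \<Gamma> r\<^sub>0.
      degenerate_Hopf F (- (3 * pi / (2 * \<sigma>))) I U J \<Gamma> r\<^sub>0 \<and>
      (\<sigma> > 0 \<longrightarrow> subcritical F I J \<and> J = {\<mu>\<in>I. \<mu> < 0}) \<and>
      (\<sigma> < 0 \<longrightarrow> supercritical F I J \<and> J = {\<mu>\<in>I. \<mu> > 0}) \<and>
      (\<forall>\<mu>\<in>J. (\<mu> > 0 \<longrightarrow> asymptotically_stable (F \<mu>) (\<Gamma> \<mu>)) \<and>
              (\<mu> < 0 \<longrightarrow> unstable (F \<mu>) (\<Gamma> \<mu>)))"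
proof -
  obtain R m where m: "m > 0"
    and ex: "\<forall>\<mu>. \<bar>\<mu>\<bar> < m \<and> \<mu> * Am < 0 \<longrightarrow> (\<exists>P. profile R \<mu> P)"
    using profile_exists by blast
  define Pr where "Pr \<mu> = (SOME P. profile R \<mu> P)" for \<mu>
  define I where "I = {- m<..<m}"
  define J where "J = {\<mu>\<in>I. \<mu> * Am < 0}"
  define r0 where "r0 \<mu> = (if \<mu> = 0 then 0 else 1 / Pr \<mu> 0)" for \<mu>
  define k where "k = 2 * R / Am\<^sup>2"
  have pr: "profile R \<mu> (Pr \<mu>)" if "\<mu> \<in> J" for \<mu>
  proof -
    have "\<exists>P. profile R \<mu> P" using that ex by (auto simp: J_def I_def)
    then show ?thesis unfolding Pr_def by (rule someI_ex)
  qed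
  have sgn: "\<mu> * Am < 0 \<longleftrightarrow> \<mu> * \<sigma> < 0" for \<mu>
    by (simp add: Am_def mult_less_0_iff zero_less_divide_iff divide_less_0_iff zero_less_mult_iff)
  have J0: "0 \<notin> J" by (simp add: J_def)
  have c: "- (3 * pi / (2 * \<sigma>)) * \<mu> = - (\<mu> / Am)" for \<mu>
    by (simp add: Am_def)
  have r0: "r0 \<mu> = 1 / Pr \<mu> 0" if "\<mu> \<in> J" for \<mu>
    using that J0 by (auto simp: r0_def)
  have asym: "\<bar>1 / Pr \<mu> s - (- (\<mu> / Am))\<bar> \<le> k * \<mu>\<^sup>2" if "\<mu> \<in> J" for \<mu> s
    unfolding k_def by (rule profile_asymptotics[OF pr[OF that]])
  \<comment> \<open>Every radius of the orbit lies within \<open>k * \<mu>\<^sup>2\<close> of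
    \<open>- (\<mu> / Am)\<close>, uniformly in the angle, hence so does their supremum.\<close>
  have amp: "\<bar>amplitude (orbit (Pr \<mu>)) - (- (\<mu> / Am))\<bar> \<le> k * \<mu>\<^sup>2" if "\<mu> \<in> J" for \<mu>
  proof -
    have im: "amplitude (orbit (Pr \<mu>)) = (SUP s. 1 / Pr \<mu> s)"
      unfolding amplitude_def orbit_def image_image norm_orbit[OF pr[OF that]] ..
    have le: "1 / Pr \<mu> s \<le> - (\<mu> / Am) + k * \<mu>\<^sup>2" for s
      using asym[OF that, of s] by linarith
    have "(SUP s. 1 / Pr \<mu> s) \<le> - (\<mu> / Am) + k * \<mu>\<^sup>2"
      by (rule cSUP_least) (use le in auto)
    moreover have "1 / Pr \<mu> 0 \<le> (SUP s. 1 / Pr \<mu> s)"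
      by (rule cSUP_upper) (use le in \<open>auto intro!: bdd_aboveI2\<close>)
    ultimately show ?thesis unfolding im using asym[OF that, of 0] by linarith
  qed
  have Jlim: "0 islimpt J"
    unfolding islimpt_approachable
  proof (intro allI impI)
    fix e :: real assume e: "e > 0"
    define h where "h = min e m / 2"
    have h: "0 < h" "h < e" "h < m" using e m by (auto simp: h_def)
    define \<mu> where "\<mu> = - sgn Am * h"
    have "\<mu> * Am < 0" "\<bar>\<mu>\<bar> = h"
      using h Am by (auto simp: \<mu>_def sgn_if mult_less_0_iff)
    then show "\<exists>x'\<in>J. x' \<noteq> 0 \<and> dist x' 0 < e"
      using h by (intro bexI[of _ \<mu>]) (auto simp: J_def I_def abs_less_iff)
  qed
  have cont: "continuous_on (insert 0 J) r0"
    unfolding continuous_on_def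
  proof
    fix \<nu> assume "\<nu> \<in> insert 0 J"
    then consider "\<nu> = 0" | "\<nu> \<in> J" by blast
    then show "(r0 \<longlongrightarrow> r0 \<nu>) (at \<nu> within insert 0 J)"
    proof cases
      case 1
      have "\<bar>r0 \<mu>\<bar> \<le> \<bar>\<mu> / Am\<bar> + k * \<mu>\<^sup>2" if "\<mu> \<in> insert 0 J" for \<mu>
      proof (cases "\<mu> = 0")
        case False
        then have "\<mu> \<in> J" using that by simp
        then have "\<bar>r0 \<mu> - (- (\<mu> / Am))\<bar> \<le> k * \<mu>\<^sup>2" using asym[of \<mu> 0] r0[of \<mu>] by simp
        then show ?thesis by linarith
      qed (simp add: r0_def)
      then have "\<forall>\<^sub>F \<mu> in at 0 within insert 0 J. norm (r0 \<mu>) \<le> \<bar>\<mu> / Am\<bar> + k * \<mu>\<^sup>2"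
        by (auto simp: eventually_at_filter)
      moreover have "((\<lambda>\<mu>. \<bar>\<mu> / Am\<bar> + k * \<mu>\<^sup>2) \<longlongrightarrow> \<bar>0 / Am\<bar> + k * 0\<^sup>2) (at 0 within insert 0 J)"
        using Am by (intro tendsto_intros)
      ultimately have "(r0 \<longlongrightarrow> 0) (at 0 within insert 0 J)"
        by (intro Lim_null_comparison[of r0]) simp_all
      then show ?thesis by (simp add: 1 r0_def[of 0])
    next
      case 2
      then have nu: "\<nu> \<noteq> 0" using J0 by blast
      \<comment> \<open>In the estimate for two profiles the moving parameter is put first, so that
        this factor stays fixed and the bound tends to 0 as \<open>\<mu>\<close> tends to
        \<open>\<nu>\<close>.\<close>
      define K where "K = \<bar>Am\<bar> / \<bar>\<nu>\<bar> + R"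
      have "\<forall>\<^sub>F \<mu> in at \<nu> within insert 0 J. \<mu> \<noteq> 0"
        using nu by (intro tendsto_imp_eventually_ne[OF tendsto_ident_at])
      moreover have "\<forall>\<^sub>F \<mu> in at \<nu> within insert 0 J. \<mu> \<in> insert 0 J"
        by (auto simp: eventually_at_filter)
      ultimately have inJ: "\<forall>\<^sub>F \<mu> in at \<nu> within insert 0 J. \<mu> \<in> J"
        by eventually_elim auto
      have "\<forall>\<^sub>F \<mu> in at \<nu> within insert 0 J. norm (Pr \<mu> 0 - Pr \<nu> 0) \<le> 4 * \<bar>\<mu> - \<nu>\<bar> / \<bar>\<mu>\<bar> * K"
        using inJ by eventually_elim (use profile_dist[OF pr pr[OF 2]] in \<open>simp add: K_def\<close>)
      moreover have "((\<lambda>\<mu>. 4 * \<bar>\<mu> - \<nu>\<bar> / \<bar>\<mu>\<bar> * K) \<longlongrightarrow> 4 * \<bar>\<nu> - \<nu>\<bar> / \<bar>\<nu>\<bar> * K) (at \<nu> within insert 0 J)"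
        using nu by (intro tendsto_intros) auto
      ultimately have "((\<lambda>\<mu>. Pr \<mu> 0 - Pr \<nu> 0) \<longlongrightarrow> 0) (at \<nu> within insert 0 J)"
        by (intro Lim_null_comparison[of "\<lambda>\<mu>. Pr \<mu> 0 - Pr \<nu> 0"]) simp_all
      then have lim: "((\<lambda>\<mu>. Pr \<mu> 0) \<longlongrightarrow> Pr \<nu> 0) (at \<nu> within insert 0 J)"
        by (rule LIM_zero_cancel)
      have "Pr \<nu> 0 \<noteq> 0" using pr[OF 2] unfolding profile_def by (metis less_irrefl)
      then have "((\<lambda>\<mu>. 1 / Pr \<mu> 0) \<longlongrightarrow> 1 / Pr \<nu> 0) (at \<nu> within insert 0 J)"
        by (intro tendsto_intros lim)
      moreover have "\<forall>\<^sub>F \<mu> in at \<nu> within insert 0 J. 1 / Pr \<mu> 0 = r0 \<mu>"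
        using inJ by eventually_elim (simp add: r0)
      ultimately show ?thesis
        unfolding r0[OF 2] by (rule Lim_transform_eventually)
    qed
  qed
  have inJ: "\<forall>\<^sub>F \<mu> in at 0 within J. \<mu> \<in> J"
    by (auto simp: eventually_at_filter)
  have bigo: "(\<lambda>\<mu>. r0 \<mu> - (- (3 * pi / (2 * \<sigma>))) * \<mu>) \<in> O[at 0 within J](\<lambda>\<mu>. \<mu>\<^sup>2)"
  proof (rule bigoI[where c = k])
    show "\<forall>\<^sub>F \<mu> in at 0 within J. norm (r0 \<mu> - (- (3 * pi / (2 * \<sigma>))) * \<mu>) \<le> k * norm (\<mu>\<^sup>2)"
      using inJ
    proof eventually_elim
      case (elim \<mu>)
      then show ?case unfolding c using asym[OF elim, of 0] r0[OF elim] by simp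
    qed
  qed
  have equiv: "(\<lambda>\<mu>. amplitude (orbit (Pr \<mu>))) \<sim>[at 0 within J] r0"
    unfolding asymp_equiv_altdef
  proof (rule landau_o.smallI)
    fix d :: real assume d: "d > 0"
    \<comment> \<open>The aim is \<open>2 * (k * \<mu>\<^sup>2) \<le> d * (\<bar>\<mu>\<bar> /
      \<bar>Am\<bar> - k * \<mu>\<^sup>2)\<close>, which holds once \<open>\<bar>\<mu>\<bar> *
      \<bar>Am\<bar> * \<bar>k\<bar> * (2 + d) \<le> d\<close>; the summand 1 keeps the denominator
      positive when \<open>k = 0\<close>.\<close>
    define e where "e = d / (\<bar>Am\<bar> * (\<bar>k\<bar> * (2 + d) + 1))"
    have kd: "\<bar>k\<bar> * (2 + d) + 1 > 0" using d by (intro add_nonneg_pos) auto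
    have e: "e > 0" using d Am kd by (simp add: e_def)
    have "\<forall>\<^sub>F \<mu> in at 0 within J. \<bar>\<mu>\<bar> < e"
      using e order_tendstoD(2)[OF tendsto_rabs[OF tendsto_ident_at[of 0 J]], of e] by simp
    with inJ show "\<forall>\<^sub>F \<mu> in at 0 within J. norm (amplitude (orbit (Pr \<mu>)) - r0 \<mu>) \<le> d * norm (r0 \<mu>)"
    proof eventually_elim
      case (elim \<mu>)
      have r: "r0 \<mu> > 0" using r0[OF elim(1)] pr[OF elim(1)] by (simp add: profile_def)
      have 1: "\<bar>amplitude (orbit (Pr \<mu>)) - r0 \<mu>\<bar> \<le> 2 * (k * \<mu>\<^sup>2)"
        using amp[OF elim(1)] asym[OF elim(1), of 0] r0[OF elim(1)] by linarith
      have "- (\<mu> / Am) > 0"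
        using elim(1) by (auto simp: J_def mult_less_0_iff divide_less_0_iff)
      then have "- (\<mu> / Am) = \<bar>\<mu>\<bar> / \<bar>Am\<bar>" by (metis abs_divide abs_minus_cancel abs_of_pos)
      then have 2: "\<bar>\<mu>\<bar> / \<bar>Am\<bar> - k * \<mu>\<^sup>2 \<le> r0 \<mu>"
        using asym[OF elim(1), of 0] r0[OF elim(1)] by linarith
      have "\<bar>\<mu>\<bar> * (\<bar>Am\<bar> * (\<bar>k\<bar> * (2 + d) + 1)) \<le> d"
        using elim(2) Am kd by (simp add: e_def pos_less_divide_eq)
      moreover have "\<bar>\<mu>\<bar> * (\<bar>Am\<bar> * (\<bar>k\<bar> * (2 + d))) \<le> \<bar>\<mu>\<bar> * (\<bar>Am\<bar> * (\<bar>k\<bar> * (2 + d) + 1))"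
        by (intro mult_left_mono) auto
      ultimately have "\<bar>\<mu>\<bar> * (\<bar>Am\<bar> * (\<bar>k\<bar> * (2 + d))) \<le> d" by linarith
      then have "(\<bar>k\<bar> * (2 + d)) * \<bar>\<mu>\<bar> \<le> d / \<bar>Am\<bar>"
        using Am by (simp add: pos_le_divide_eq mult_ac)
      then have "\<bar>\<mu>\<bar> * ((\<bar>k\<bar> * (2 + d)) * \<bar>\<mu>\<bar>) \<le> \<bar>\<mu>\<bar> * (d / \<bar>Am\<bar>)"
        by (intro mult_left_mono) auto
      also have "\<bar>\<mu>\<bar> * ((\<bar>k\<bar> * (2 + d)) * \<bar>\<mu>\<bar>) = (2 + d) * (\<bar>k\<bar> * \<mu>\<^sup>2)"
        by (simp add: power2_eq_square)
      finally have "(2 + d) * (k * \<mu>\<^sup>2) \<le> d * (\<bar>\<mu>\<bar> / \<bar>Am\<bar>)"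
      proof -
        assume a: "(2 + d) * (\<bar>k\<bar> * \<mu>\<^sup>2) \<le> \<bar>\<mu>\<bar> * (d / \<bar>Am\<bar>)"
        have "(2 + d) * (k * \<mu>\<^sup>2) \<le> (2 + d) * (\<bar>k\<bar> * \<mu>\<^sup>2)"
          using d by (intro mult_left_mono mult_right_mono) auto
        with a show ?thesis by (simp add: mult.commute)
      qed
      then have "2 * (k * \<mu>\<^sup>2) \<le> d * (\<bar>\<mu>\<bar> / \<bar>Am\<bar> - k * \<mu>\<^sup>2)"
        by (simp add: algebra_simps)
      also have "\<dots> \<le> d * r0 \<mu>" using 2 d by (intro mult_left_mono) auto
      finally show ?case using 1 r by simp
    qed
  qed
  have axis: "r0 \<mu> > 0 \<and> {r. r \<ge> 0 \<and> (r, 0) \<in> orbit (Pr \<mu>)} = {r0 \<mu>}" if "\<mu> \<in> J" for \<mu>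
  proof -
    have P: "Pr \<mu> s > 0" "Pr \<mu> (s + 2 * pi) = Pr \<mu> s" for s
      using pr[OF that] by (auto simp: profile_def)
    have "r = 1 / Pr \<mu> 0" if "r \<ge> 0" "(r, 0) \<in> orbit (Pr \<mu>)" for r
    proof -
      have "(r, 0) \<noteq> (0 :: real \<times> real)" "D (Pr \<mu>) (r, 0) = 0"
        using that orbit_iff[OF pr[OF \<open>\<mu> \<in> J\<close>]] by blast+
      moreover from this(1) have "r > 0" using that(1) by (auto simp: zero_prod_def)
      moreover from this have "Pr \<mu> (angle (r * cos 0, r * sin 0)) = Pr \<mu> 0"
        by (intro periodic_2pi_angle_polar[of "Pr \<mu>"] P(2))
      ultimately show ?thesis using P(1)[of 0] by (simp add: D_def field_simps)
    qed
    moreover have "(1 / Pr \<mu> 0, 0) \<in> orbit (Pr \<mu>)"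
      unfolding orbit_def by (rule image_eqI[of _ _ 0]) auto
    ultimately show ?thesis using P(1)[of 0] by (auto simp: r0[OF that])
  qed
  have orbits: "periodic_orbit (F \<mu>) Q \<and> Q \<subseteq> ball 0 \<delta> \<longleftrightarrow> \<mu> \<in> J \<and> Q = orbit (Pr \<mu>)"
    if "\<mu> \<in> I" for \<mu> Q
  proof (cases "\<mu> \<in> J")
    case True
    then show ?thesis using periodic_orbit_iff[OF pr[OF True]] by simp
  next
    case False
    then have "\<mu> * Am \<ge> 0" using that by (simp add: J_def)
    then show ?thesis using no_periodic_orbit False by blast
  qed
  have "degenerate_Hopf F (- (3 * pi / (2 * \<sigma>))) I (ball 0 \<delta>) J (\<lambda>\<mu>. orbit (Pr \<mu>)) r0"
    unfolding degenerate_Hopf_def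
  proof (intro conjI)
    show "is_interval I" "open I" "0 \<in> I" using m by (auto simp: I_def is_interval_oo)
    show "(0, 0) \<in> ball 0 \<delta>" using delta by (simp add: zero_prod_def[symmetric])
    show "\<forall>\<mu>\<in>I. F \<mu> (0, 0) = (0, 0)" using F_zero by (simp add: zero_prod_def)
    show "J \<subseteq> I - {0}" by (auto simp: J_def)
    show "- (3 * pi / (2 * \<sigma>)) \<noteq> 0" using sigma by simp
    show "r0 0 = 0" by (simp add: r0_def)
    show "\<forall>\<mu>\<in>J. 0 < r0 \<mu> \<and> {r. 0 \<le> r \<and> (r, 0) \<in> orbit (Pr \<mu>)} = {r0 \<mu>}"
      using axis by blast
  qed (use orbits Jlim cont equiv bigo in \<open>auto simp only: open_ball\<close>)
  moreover have "subcritical F I J \<and> J = {\<mu>\<in>I. \<mu> < 0}" if "\<sigma> > 0"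
  proof -
    have J: "J = {\<mu>\<in>I. \<mu> < 0}" unfolding J_def sgn using that by (auto simp: mult_less_0_iff)
    have "\<mu> > 0" if "\<mu> \<in> I - J - {0}" for \<mu>
      using that unfolding J by auto
    moreover have "\<mu> < 0" if "\<mu> \<in> J" for \<mu> using that unfolding J by auto
    ultimately show ?thesis
      using origin_asymptotically_stable origin_unstable J
      unfolding subcritical_def zero_prod_def[symmetric] by blast
  qed
  moreover have "supercritical F I J \<and> J = {\<mu>\<in>I. \<mu> > 0}" if "\<sigma> < 0"
  proof -
    have J: "J = {\<mu>\<in>I. \<mu> > 0}" unfolding J_def sgn using that by (auto simp: mult_less_0_iff)
    have "\<mu> < 0" if "\<mu> \<in> I - J - {0}" for \<mu>
      using that unfolding J by auto
    moreover have "\<mu> > 0" if "\<mu> \<in> J" for \<mu> using that unfolding J by auto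
    ultimately show ?thesis
      using origin_asymptotically_stable origin_unstable J
      unfolding supercritical_def zero_prod_def[symmetric] by blast
  qed
  moreover have "\<forall>\<mu>\<in>J. (\<mu> > 0 \<longrightarrow> asymptotically_stable (F \<mu>) (orbit (Pr \<mu>))) \<and>
              (\<mu> < 0 \<longrightarrow> unstable (F \<mu>) (orbit (Pr \<mu>)))"
    using pr orbit_asymptotically_stable orbit_unstable by blast
  ultimately show ?thesis by blast
qed

end

theorem theorem3p10:
  fixes \<omega> a11 a12 a21 a22 b11 b12 b21 b22 \<sigma> :: real
    and f g :: "real \<Rightarrow> real \<Rightarrow> real"
  assumes "\<omega> \<noteq> 0"
    and "\<And>v w. f v w = a11 * v * \<bar>v\<bar> + a12 * v * \<bar>w\<bar> + a21 * w * \<bar>v\<bar> + a22 * w * \<bar>w\<bar>"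
    and "\<And>v w. g v w = b11 * v * \<bar>v\<bar> + b12 * v * \<bar>w\<bar> + b21 * w * \<bar>v\<bar> + b22 * w * \<bar>w\<bar>"
    and "\<sigma> = 2 * a11 + a12 + b21 + 2 * b22"
    and "\<sigma> \<noteq> 0"
  shows "\<exists>I U J \<Gamma> r\<^sub>0.
      degenerate_Hopf (planar_system \<omega> f g) (- (3 * pi / (2 * \<sigma>))) I U J \<Gamma> r\<^sub>0 \<and>
      (\<sigma> > 0 \<longrightarrow> subcritical (planar_system \<omega> f g) I J \<and> J = {\<mu>\<in>I. \<mu> < 0}) \<and>
      (\<sigma> < 0 \<longrightarrow> supercritical (planar_system \<omega> f g) I J \<and> J = {\<mu>\<in>I. \<mu> > 0}) \<and>
      (\<forall>\<mu>\<in>J. (\<mu> > 0 \<longrightarrow> asymptotically_stable (planar_system \<omega> f g \<mu>) (\<Gamma> \<mu>)) \<and>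
              (\<mu> < 0 \<longrightarrow> unstable (planar_system \<omega> f g \<mu>) (\<Gamma> \<mu>)))"
proof -
  interpret piecewise_quadratic_system \<omega> a11 a12 a21 a22 b11 b12 b21 b22 \<sigma> f g
    by unfold_locales (fact assms)+
  show ?thesis by (rule Hopf_bifurcation)
qed

end
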